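(* Let $A$ be a complete commutative continuous inverse algebra, $G$ a compact group and $(A,G,\alpha)$ a dynamical system. Then each character $\chi:A^G\to\mathbb{C}$ extends to a character $\widetilde{\chi}:A\to\mathbb{C}$.
   Context: The ground field is $\mathbb{C}$. A continuous inverse algebra (CIA) is a unital locally convex algebra (jointly continuous multiplication) whose group of units $A^{\times}$ is open in $A$ and for which the inversion $A^\times\to A^\times$ is continuous at $1_A$. A dynamical system $(A,G,\alpha)$ consists of a unital locally convex algebra $A$, a topological group $G$ and a group homomorphism $\alpha:G\to\operatorname{Aut}(A)$ such that $G\times A\to A$, $(g,a)\mapsto\alpha(g)(a)$ is continuous. $A^G=\{a\in A:\alpha(g)(a)=a\ \forall g\in G\}$ is the fixed point algebra. A character of an algebra is a nonzero algebra homomorphism to $\mathbb{C}$. *)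

theory Defs
  imports "HOL-Analysis.Analysis"
begin

class complex_algebra_1 = real_algebra_1 +
  fixes scaleC :: "complex \<Rightarrow> 'a \<Rightarrow> 'a"  (infixr \<open>*\<^sub>C\<close> 75)
  assumes scaleC_add_right: "c *\<^sub>C (x + y) = c *\<^sub>C x + c *\<^sub>C y"
    and scaleC_add_left: "(c + d) *\<^sub>C x = c *\<^sub>C x + d *\<^sub>C x"
    and scaleC_scaleC: "c *\<^sub>C d *\<^sub>C x = (c * d) *\<^sub>C x"
    and scaleC_one: "1 *\<^sub>C x = x"
    and scaleC_of_real: "complex_of_real r *\<^sub>C x = r *\<^sub>R x"
    and mult_scaleC_left: "(c *\<^sub>C x) * y = c *\<^sub>C (x * y)"
    and mult_scaleC_right: "x * (c *\<^sub>C y) = c *\<^sub>C (x * y)"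

text \<open>Locally convex spaces are Hausdorff, as is customary. Being a
  \<^class>\<open>uniform_topological_group_add\<close>, the algebra carries the translation-invariant uniformity
  determined by its topology (lemma \<open>uniformity_eq\<close> below), so that
  \<^const>\<open>complete\<close> is completeness as a topological vector space, in terms of Cauchy filters.\<close>

class locally_convex_algebra_1 =
  complex_algebra_1 + t2_space + uniform_topological_group_add + topological_semigroup_mult +
  assumes tendsto_scaleC_Pair:
      "LIM p (nhds c \<times>\<^sub>F nhds x). fst p *\<^sub>C snd p :> nhds (c *\<^sub>C x)"
    and locally_convex:
      "\<lbrakk>open U; 0 \<in> U\<rbrakk> \<Longrightarrow> \<exists>V. open V \<and> 0 \<in> V \<and> V \<subseteq> U \<and>
        (\<forall>x\<in>V. \<forall>y\<in>V. \<forall>u\<ge>0. \<forall>v\<ge>0. u + v = 1 \<longrightarrow> u *\<^sub>R x + v *\<^sub>R y \<in> V)"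

lemma open_convex_neighbourhood:
  fixes U :: "'a::locally_convex_algebra_1 set"
  assumes "open U" "0 \<in> U"
  shows "\<exists>V. open V \<and> 0 \<in> V \<and> V \<subseteq> U \<and> convex V"
  unfolding convex_def using assms by (rule locally_convex)

lemma uniformity_eq:
  "(uniformity :: ('a :: locally_convex_algebra_1 \<times> 'a) filter) =
     filtercomap (\<lambda>(x, y). y - x) (nhds 0)"
  by (rule cauchy_seq_finset_iff_vanishing)

definition (in ring_1) ring_units :: "'a set"
  where "ring_units = {x. \<exists>y. x * y = 1 \<and> y * x = 1}"

definition (in ring_1) ring_inverse :: "'a \<Rightarrow> 'a"
  where "ring_inverse x = (THE y. x * y = 1 \<and> y * x = 1)"

lemma (in ring_1) ring_inverse_eq:
  assumes "x * y = 1" "y * x = 1"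
  shows "ring_inverse x = y"
  unfolding ring_inverse_def
proof (rule the_equality)
  fix z assume "x * z = 1 \<and> z * x = 1"
  then show "z = y"
    by (metis assms(2) local.mult.assoc local.mult_1_left local.mult_1_right)
qed (use assms in simp)

class continuous_inverse_algebra = locally_convex_algebra_1 +
  assumes open_ring_units: "open ring_units"
    and tendsto_ring_inverse: "(ring_inverse \<longlongrightarrow> 1) (at 1 within ring_units)"

lemma continuous_ring_inverse:
  "continuous (at 1 within ring_units) (ring_inverse :: 'a::continuous_inverse_algebra \<Rightarrow> 'a)"
  using tendsto_ring_inverse by (simp add: continuous_within ring_inverse_eq)

definition algebra_automorphism :: "('a::complex_algebra_1 \<Rightarrow> 'a) \<Rightarrow> bool"
  where "algebra_automorphism f \<longleftrightarrow>
    bij f \<and> (\<forall>x y. f (x + y) = f x + f y) \<and> (\<forall>c x. f (c *\<^sub>C x) = c *\<^sub>C f x) \<and>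
    (\<forall>x y. f (x * y) = f x * f y) \<and> f 1 = 1"

text \<open>The acting group is written additively, but it need not be commutative. Each
  \<open>\<alpha> g\<close> is automatically a homeomorphism, with continuous inverse
  \<open>\<alpha> (- g)\<close>.\<close>

definition dynamical_system ::
    "('g::topological_group_add \<Rightarrow> 'a::locally_convex_algebra_1 \<Rightarrow> 'a) \<Rightarrow> bool"
  where "dynamical_system \<alpha> \<longleftrightarrow>
    (\<forall>g. algebra_automorphism (\<alpha> g)) \<and> (\<forall>g h. \<alpha> (g + h) = \<alpha> g \<circ> \<alpha> h) \<and>
    continuous_on UNIV (\<lambda>(g, a). \<alpha> g a)"

definition fixed_point_algebra :: "('g \<Rightarrow> 'a \<Rightarrow> 'a) \<Rightarrow> 'a set"
  where "fixed_point_algebra \<alpha> = {a. \<forall>g. \<alpha> g a = a}"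

text \<open>Characters of a subalgebra \<open>B\<close>, represented by functions on the whole algebra whose values
  outside \<open>B\<close> are irrelevant. Continuity is not required.\<close>

definition character_on :: "'a::complex_algebra_1 set \<Rightarrow> ('a \<Rightarrow> complex) \<Rightarrow> bool"
  where "character_on B \<phi> \<longleftrightarrow>
    (\<forall>x\<in>B. \<forall>y\<in>B. \<phi> (x + y) = \<phi> x + \<phi> y) \<and> (\<forall>c. \<forall>x\<in>B. \<phi> (c *\<^sub>C x) = c * \<phi> x) \<and>
    (\<forall>x\<in>B. \<forall>y\<in>B. \<phi> (x * y) = \<phi> x * \<phi> y) \<and> (\<exists>x\<in>B. \<phi> x \<noteq> 0)"

lemma fixed_point_algebra_closed:
  assumes "dynamical_system \<alpha>"
    and "x \<in> fixed_point_algebra \<alpha>" "y \<in> fixed_point_algebra \<alpha>"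
  shows "x + y \<in> fixed_point_algebra \<alpha>" "x * y \<in> fixed_point_algebra \<alpha>"
    "c *\<^sub>C x \<in> fixed_point_algebra \<alpha>" "1 \<in> fixed_point_algebra \<alpha>"
  using assms
  by (auto simp: dynamical_system_def algebra_automorphism_def fixed_point_algebra_def)

instantiation complex :: continuous_inverse_algebra
begin

definition scaleC_complex :: "complex \<Rightarrow> complex \<Rightarrow> complex"
  where "scaleC_complex = (*)"

instance
proof
  have units: "ring_units = - {0 :: complex}"
    unfolding ring_units_def by (auto simp: mult.commute) (metis right_inverse)
  show "open (ring_units :: complex set)"
    unfolding units by auto
  have "((inverse :: complex \<Rightarrow> complex) \<longlongrightarrow> inverse 1) (at 1 within ring_units)"
    by (intro tendsto_intros) auto
  moreover have "\<forall>\<^sub>F x in at 1 within ring_units. inverse x = ring_inverse (x :: complex)"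
    unfolding eventually_at_filter
    by (intro always_eventually) (auto simp: units intro!: ring_inverse_eq[symmetric])
  ultimately show "((ring_inverse :: complex \<Rightarrow> complex) \<longlongrightarrow> 1) (at 1 within ring_units)"
    using tendsto_cong by fastforce
  show "\<exists>V. open V \<and> 0 \<in> V \<and> V \<subseteq> U \<and>
      (\<forall>x\<in>V. \<forall>y\<in>V. \<forall>u\<ge>0. \<forall>v\<ge>0. u + v = 1 \<longrightarrow> u *\<^sub>R x + v *\<^sub>R y \<in> V)"
    if U: "open U" "0 \<in> U" for U :: "complex set"
  proof -
    obtain e where "e > 0" "ball 0 e \<subseteq> U"
      using U openE by blast
    then show ?thesis
      using convex_ball[of "0 :: complex" e, unfolded convex_def] by (intro exI[of _ "ball 0 e"]) auto
  qed
  show "LIM p (nhds c \<times>\<^sub>F nhds x). fst p *\<^sub>C snd p :> nhds (c *\<^sub>C x)" for c x :: complex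
    unfolding scaleC_complex_def by (rule tendsto_mult_Pair)
qed (auto simp: scaleC_complex_def algebra_simps scaleR_conv_of_real)

end

end

theory Submission
  imports Defs "HOL-Complex_Analysis.Cauchy_Integral_Formula"
begin

text \<open>
  Let \<open>B\<close> be the fixed point algebra. If a proper ideal \<open>J\<close> of \<open>A\<close> contains the
  kernel of \<open>\<phi>\<close>, then every character of \<open>A\<close> that vanishes on \<open>J\<close> extends \<open>\<phi>\<close>, because
  \<open>b - \<phi> b\<close> lies in the kernel for each \<open>b\<close> in \<open>B\<close>. So two things are needed: such an ideal,
  and a character that vanishes on it.

  The ideal comes from averaging over the group. There is an additive projection \<open>mean\<close> of \<open>A\<close>
  onto \<open>B\<close> with \<open>mean (a * b) = mean a * b\<close> for \<open>b\<close> in \<open>B\<close>, and \<open>J\<close> consists of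
  the \<open>x\<close> with \<open>\<phi> (mean (a * x)) = 0\<close> for all \<open>a\<close>. It contains the kernel since
  \<open>\<phi> (mean a * b) = \<phi> (mean a) * \<phi> b\<close>, and it does not contain \<open>1\<close> since
  \<open>\<phi> (mean 1) = 1\<close>. Instead of integrating with respect to Haar measure, the mean is obtained, after
  von Neumann, as a limit of finite averages \<open>T\<close> of the operators \<open>\<alpha> h\<close>. Measured in an
  invariant seminorm, a high power of one such average makes both functions
  \<open>g \<mapsto> \<alpha> g (T a)\<close> and \<open>g \<mapsto> T (\<alpha> g a)\<close> almost constant
  (lemma \<open>oscillation_of_iterated_average\<close>). If \<open>T\<close> and \<open>T'\<close> both have these properties, then
  \<open>T (T' a)\<close> is close to \<open>T' a\<close> by the first and to \<open>T a\<close> by the second. Hence the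
  approximate means \<open>T a\<close> form a Cauchy filter, and completeness provides the limit.

  The character comes from a maximal ideal \<open>M\<close> above \<open>J\<close> and the Gelfand-Mazur argument
  (theorem \<open>scalar_modulo_maximal_ideal\<close>): were \<open>a - z\<close> invertible modulo \<open>M\<close> for every complex
  \<open>z\<close>, then a continuous functional \<open>L\<close> that vanishes on \<open>M\<close> but not at \<open>1\<close> would turn the
  resolvent into an entire function vanishing at infinity, and Liouville's theorem would force
  \<open>L 1 = 0\<close>. Hence every \<open>a\<close> differs from an element of \<open>M\<close> by a scalar, and this scalar is the
  value of the character. The functional exists by the Hahn-Banach theorem, because the open set of units
  separates \<open>1\<close> from \<open>M\<close>.
\<close>

section \<open>Seminorms and gauges\<close>

definition seminorm :: "('a::real_vector \<Rightarrow> real) \<Rightarrow> bool"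
  where "seminorm p \<longleftrightarrow> (\<forall>x y. p (x + y) \<le> p x + p y) \<and> (\<forall>r x. p (r *\<^sub>R x) = \<bar>r\<bar> * p x)"

lemma seminorm_triangle: "seminorm p \<Longrightarrow> p (x + y) \<le> p x + p y"
  and seminorm_scaleR: "seminorm p \<Longrightarrow> p (r *\<^sub>R x) = \<bar>r\<bar> * p x"
  by (auto simp: seminorm_def)

lemma seminorm_zero: "seminorm p \<Longrightarrow> p 0 = 0"
  using seminorm_scaleR[of p 0 0] by simp

lemma seminorm_minus: "seminorm p \<Longrightarrow> p (- x) = p x"
  using seminorm_scaleR[of p "-1" x] by simp

lemma seminorm_commute: "seminorm p \<Longrightarrow> p (x - y) = p (y - x)"
  using seminorm_minus[of p "x - y"] by simp

lemma seminorm_triangle_diff: "seminorm p \<Longrightarrow> p (x - z) \<le> p (x - y) + p (y - z)"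
  using seminorm_triangle[of p "x - y" "y - z"] by simp

lemma seminorm_nonneg: "seminorm p \<Longrightarrow> 0 \<le> p x"
  using seminorm_triangle[of p x "- x"] by (simp add: seminorm_minus seminorm_zero)

lemma seminorm_sum:
  assumes "seminorm p"
  shows "p (sum u H) \<le> (\<Sum>h\<in>H. p (u h))"
proof (cases "finite H")
  case True
  then show ?thesis
  proof (induction H)
    case (insert h H)
    then show ?case
      using seminorm_triangle[OF assms, of "u h" "sum u H"] by simp
  qed (simp add: seminorm_zero assms)
qed (simp add: seminorm_zero assms)

definition average :: "('h \<Rightarrow> 'a::real_vector) \<Rightarrow> 'h set \<Rightarrow> 'a"
  where "average u H = (1 / real (card H)) *\<^sub>R sum u H"

lemma linear_average: "linear S \<Longrightarrow> S (average u H) = average (\<lambda>h. S (u h)) H"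
  by (simp add: average_def linear_cmul linear_sum)

lemma average_diff_const:
  assumes "finite H" "H \<noteq> {}"
  shows "average u H - c = average (\<lambda>h. u h - c) H"
proof -
  have "average (\<lambda>h. c) H = c"
    using assms by (simp add: average_def sum_constant_scaleR)
  then show ?thesis
    by (simp add: average_def sum_subtractf algebra_simps)
qed

lemma seminorm_average_le:
  assumes "seminorm p" "finite H" "H \<noteq> {}" "\<And>h. h \<in> H \<Longrightarrow> p (u h) \<le> e"
  shows "p (average u H) \<le> e"
proof -
  have "p (average u H) = p (sum u H) / real (card H)"
    by (simp add: average_def seminorm_scaleR[OF assms(1)])
  also have "\<dots> \<le> (\<Sum>h\<in>H. p (u h)) / real (card H)"
    by (intro divide_right_mono seminorm_sum assms) simp
  also have "\<dots> \<le> (real (card H) * e) / real (card H)"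
    using assms by (intro divide_right_mono sum_bounded_above) auto
  also have "\<dots> = e"
    using assms by simp
  finally show ?thesis .
qed

text \<open>One close pair already pulls two averages together: pair the index \<open>k\<close> with \<open>k'\<close>
  and the other indices arbitrarily. Then one of the \<open>card H\<close> differences is at most \<open>e\<close> and the
  others are at most \<open>d\<close>. This gain over the trivial bound \<open>d\<close> drives the construction of the mean.\<close>
lemma seminorm_average_diff_le:
  assumes p: "seminorm p" and H: "finite H" "k \<in> H" "k' \<in> H"
    and close: "p (u k - v k') \<le> e"
    and bound: "\<And>h h'. h \<in> H \<Longrightarrow> h' \<in> H \<Longrightarrow> p (u h - v h') \<le> d"
  shows "p (average u H - average v H) \<le> (e + (real (card H) - 1) * d) / real (card H)"
proof -
  define \<sigma> where "\<sigma> = Transposition.transpose k k'"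
  have perm: "\<sigma> permutes H"
    unfolding \<sigma>_def using H by (intro permutes_swap_id) auto
  have "average v H = average (\<lambda>h. v (\<sigma> h)) H"
    unfolding average_def using sum.permute[OF perm, of v] unfolding o_def by (rule arg_cong)
  then have "average u H - average v H = (1 / real (card H)) *\<^sub>R (\<Sum>h\<in>H. u h - v (\<sigma> h))"
    unfolding average_def by (simp only: sum_subtractf scaleR_diff_right)
  then have "p (average u H - average v H) = p (\<Sum>h\<in>H. u h - v (\<sigma> h)) / real (card H)"
    by (simp add: seminorm_scaleR[OF p])
  also have "p (\<Sum>h\<in>H. u h - v (\<sigma> h)) \<le> (\<Sum>h\<in>H. p (u h - v (\<sigma> h)))"
    by (rule seminorm_sum[OF p])
  also have "\<dots> = p (u k - v (\<sigma> k)) + (\<Sum>h\<in>H - {k}. p (u h - v (\<sigma> h)))"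
    using H by (simp add: sum.remove)
  also have "\<dots> \<le> e + (\<Sum>h\<in>H - {k}. d)"
    using H close permutes_in_image[OF perm]
    by (intro add_mono sum_mono bound) (auto simp: \<sigma>_def)
  also have "(\<Sum>h\<in>H - {k}. d) = (real (card H) - 1) * d"
    using H card_gt_0_iff[of H] by (auto simp: of_nat_diff Suc_leI)
  finally show ?thesis
    by (simp add: divide_right_mono)
qed

text \<open>The Minkowski functional.\<close>
definition gauge_of :: "'a::real_vector set \<Rightarrow> 'a \<Rightarrow> real"
  where "gauge_of W x = Inf {t. 0 < t \<and> inverse t *\<^sub>R x \<in> W}"

lemma tendsto_scaleC:
  fixes g :: "'b \<Rightarrow> 'a::locally_convex_algebra_1"
  assumes "(f \<longlongrightarrow> c) F" "(g \<longlongrightarrow> x) F"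
  shows "((\<lambda>y. f y *\<^sub>C g y) \<longlongrightarrow> c *\<^sub>C x) F"
  using filterlim_compose[OF tendsto_scaleC_Pair filterlim_Pair[OF assms]] by simp

lemma tendsto_scaleR_const:
  fixes g :: "'b \<Rightarrow> 'a::locally_convex_algebra_1"
  assumes "(f \<longlongrightarrow> c) F" "(g \<longlongrightarrow> x) F"
  shows "((\<lambda>y. f y *\<^sub>R g y) \<longlongrightarrow> c *\<^sub>R x) F"
  using tendsto_scaleC[OF tendsto_of_real[OF assms(1)] assms(2)] by (simp add: scaleC_of_real)

text \<open>A neighbourhood of \<open>0\<close> rather than an open set, to allow for the intersection of all translates
  of an open set under a compact group.\<close>
locale absorbing_disc =
  fixes W :: "'a::locally_convex_algebra_1 set"
  assumes convex: "convex W"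
    and uminus_mem: "\<And>x. x \<in> W \<Longrightarrow> - x \<in> W"
    and nhd: "\<forall>\<^sub>F x in nhds 0. x \<in> W"
begin

lemma zero_mem: "0 \<in> W"
  using nhd eventually_nhds_x_imp_x by blast

lemma absorbing: "\<exists>t>0. inverse t *\<^sub>R x \<in> W"
proof -
  have "((\<lambda>t. inverse t *\<^sub>R x) \<longlongrightarrow> 0 *\<^sub>R x) at_top"
    by (intro tendsto_scaleR_const tendsto_inverse_0_at_top filterlim_ident tendsto_const)
  then have "\<forall>\<^sub>F t in at_top. inverse t *\<^sub>R x \<in> W"
    using eventually_compose_filterlim[OF nhd] by simp
  then have "\<forall>\<^sub>F t::real in at_top. 0 < t \<and> inverse t *\<^sub>R x \<in> W"
    using eventually_gt_at_top[of 0] by eventually_elim auto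
  then show ?thesis
    using eventually_happens'[OF trivial_limit_at_top_linorder] by blast
qed

lemma gauge_le: "gauge_of W x \<le> t" if "0 < t" "inverse t *\<^sub>R x \<in> W"
  unfolding gauge_of_def using that by (intro cInf_lower bdd_belowI[of _ 0]) auto

lemma gauge_lessE:
  assumes "gauge_of W x < t"
  obtains s where "0 < s" "s < t" "inverse s *\<^sub>R x \<in> W"
proof -
  have "{t. 0 < t \<and> inverse t *\<^sub>R x \<in> W} \<noteq> {}"
    using absorbing[of x] by auto
  from cInf_lessD[OF this assms[unfolded gauge_of_def]] show ?thesis
    using that by blast
qed

lemma gauge_nonneg: "0 \<le> gauge_of W x"
  unfolding gauge_of_def using absorbing[of x] by (intro cInf_greatest) auto

lemma gauge_triangle: "gauge_of W (x + y) \<le> gauge_of W x + gauge_of W y"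
proof (rule field_le_epsilon)
  fix e :: real assume "0 < e"
  obtain s where s: "0 < s" "s < gauge_of W x + e / 2" "inverse s *\<^sub>R x \<in> W"
    using gauge_lessE[of x "gauge_of W x + e / 2"] \<open>0 < e\<close> by auto
  obtain t where t: "0 < t" "t < gauge_of W y + e / 2" "inverse t *\<^sub>R y \<in> W"
    using gauge_lessE[of y "gauge_of W y + e / 2"] \<open>0 < e\<close> by auto
  have "(s / (s + t)) *\<^sub>R (inverse s *\<^sub>R x) + (t / (s + t)) *\<^sub>R (inverse t *\<^sub>R y) \<in> W"
    using s t by (intro convexD[OF convex]) (auto simp: add_divide_distrib[symmetric])
  then have "inverse (s + t) *\<^sub>R (x + y) \<in> W"
    using s(1) t(1) by (simp add: scaleR_add_right inverse_eq_divide)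
  then have "gauge_of W (x + y) \<le> s + t"
    using s t by (intro gauge_le) auto
  then show "gauge_of W (x + y) \<le> gauge_of W x + gauge_of W y + e"
    using s t by simp
qed

lemma gauge_minus: "gauge_of W (- x) = gauge_of W x"
proof -
  have "- y \<in> W \<longleftrightarrow> y \<in> W" for y
    using uminus_mem[of y] uminus_mem[of "- y"] by auto
  then show ?thesis
    by (simp add: gauge_of_def)
qed

lemma gauge_zero: "gauge_of W 0 = 0"
proof (rule antisym)
  show "gauge_of W 0 \<le> 0"
    by (rule field_le_epsilon) (use gauge_le[of _ 0] zero_mem in auto)
qed (rule gauge_nonneg)

lemma gauge_scaleR_pos_le: "gauge_of W (r *\<^sub>R x) \<le> r * gauge_of W x" if "0 < r"
proof (rule field_le_epsilon)
  fix e :: real assume "0 < e"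
  obtain s where s: "0 < s" "s < gauge_of W x + e / r" "inverse s *\<^sub>R x \<in> W"
    using gauge_lessE[of x "gauge_of W x + e / r"] \<open>0 < e\<close> \<open>0 < r\<close> by auto
  then have "gauge_of W (r *\<^sub>R x) \<le> r * s"
    using \<open>0 < r\<close> by (intro gauge_le) (auto simp: field_simps)
  also have "\<dots> \<le> r * (gauge_of W x + e / r)"
    using s \<open>0 < r\<close> by (intro mult_left_mono) auto
  finally show "gauge_of W (r *\<^sub>R x) \<le> r * gauge_of W x + e"
    using \<open>0 < r\<close> by (simp add: algebra_simps)
qed

lemma gauge_scaleR_pos: "gauge_of W (r *\<^sub>R x) = r * gauge_of W x" if "0 < r"
proof (rule antisym)
  have "gauge_of W x \<le> inverse r * gauge_of W (r *\<^sub>R x)"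
    using gauge_scaleR_pos_le[of "inverse r" "r *\<^sub>R x"] that by simp
  then show "r * gauge_of W x \<le> gauge_of W (r *\<^sub>R x)"
    using that by (simp add: field_simps)
qed (rule gauge_scaleR_pos_le[OF that])

lemma seminorm_gauge: "seminorm (gauge_of W)"
proof -
  have "gauge_of W (r *\<^sub>R x) = \<bar>r\<bar> * gauge_of W x" for r x
    using gauge_scaleR_pos[of r x] gauge_scaleR_pos[of "- r" x] gauge_minus[of "r *\<^sub>R x"]
    by (cases r "0 :: real" rule: linorder_cases) (auto simp: gauge_zero)
  then show ?thesis
    by (simp add: seminorm_def gauge_triangle)
qed

lemma tendsto_gauge: "(gauge_of W \<longlongrightarrow> 0) (nhds 0)"
proof (rule tendstoI)
  fix e :: real assume "0 < e"
  have "((\<lambda>x. inverse (e / 2) *\<^sub>R x) \<longlongrightarrow> inverse (e / 2) *\<^sub>R 0) (nhds (0 :: 'a))"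
    by (intro tendsto_scaleR_const tendsto_const filterlim_ident)
  then have "\<forall>\<^sub>F x in nhds 0. inverse (e / 2) *\<^sub>R x \<in> W"
    using eventually_compose_filterlim[OF nhd] by simp
  then show "\<forall>\<^sub>F x in nhds 0. dist (gauge_of W x) 0 < e"
  proof eventually_elim
    case (elim x)
    then show ?case
      using gauge_le[of "e / 2" x] \<open>0 < e\<close> gauge_nonneg[of x] by simp
  qed
qed

lemma mem_if_gauge_less_1: "x \<in> W" if "gauge_of W x < 1"
proof -
  obtain s where s: "0 < s" "s < 1" "inverse s *\<^sub>R x \<in> W"
    using gauge_lessE[of x 1] \<open>gauge_of W x < 1\<close> by blast
  then have "s *\<^sub>R (inverse s *\<^sub>R x) + (1 - s) *\<^sub>R 0 \<in> W"
    by (intro convexD[OF convex] zero_mem) auto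
  then show ?thesis
    using s by simp
qed

end

lemma symmetric_convex_neighbourhood:
  fixes U :: "'a::locally_convex_algebra_1 set"
  assumes "open U" "0 \<in> U"
  obtains V where "open V" "V \<subseteq> U" "absorbing_disc V"
proof -
  obtain V where V: "open V" "0 \<in> V" "V \<subseteq> U" "convex V"
    using open_convex_neighbourhood[OF assms] by blast
  have "open (V \<inter> uminus -` V)"
    using V by (intro open_Int open_vimage continuous_intros) auto
  moreover have "convex (V \<inter> uminus -` V)"
    using V by (intro convex_Int convex_linear_vimage linear_uminus) auto
  ultimately show ?thesis
    using V eventually_nhds_in_open[of "V \<inter> uminus -` V" 0]
    by (intro that[of "V \<inter> uminus -` V"]) (auto simp: absorbing_disc_def)
qed

lemma continuous_on_seminorm:
  fixes p :: "'a::locally_convex_algebra_1 \<Rightarrow> real"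
  assumes p: "seminorm p" and lim: "(p \<longlongrightarrow> 0) (nhds 0)"
  shows "continuous_on UNIV p"
proof -
  have "(p \<longlongrightarrow> p x) (at x)" for x
  proof (rule Lim_null[THEN iffD2], rule Lim_null_comparison)
    have "((\<lambda>y. y - x) \<longlongrightarrow> x - x) (at x)"
      by (intro tendsto_diff tendsto_ident_at tendsto_const)
    then show "((\<lambda>y. p (y - x)) \<longlongrightarrow> 0) (at x)"
      using filterlim_compose[OF lim] by simp
    have "norm (p y - p x) \<le> p (y - x)" for y
      using seminorm_triangle[OF p, of "y - x" x] seminorm_triangle[OF p, of "x - y" y]
      by (simp add: seminorm_commute[OF p, of y x] abs_le_iff)
    then show "\<forall>\<^sub>F y in at x. norm (p y - p x) \<le> p (y - x)"
      by simp
  qed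
  then show ?thesis
    by (simp add: continuous_on_def)
qed

section \<open>Invariant seminorms\<close>

locale compact_dynamical_system =
  fixes \<alpha> :: "'g::topological_group_add \<Rightarrow> 'a::locally_convex_algebra_1 \<Rightarrow> 'a"
  assumes compact_group: "compact (UNIV :: 'g set)"
    and dynamical: "dynamical_system \<alpha>"
begin

lemma action_plus: "\<alpha> (g + h) x = \<alpha> g (\<alpha> h x)"
  using dynamical by (simp add: dynamical_system_def)

lemma action_hom:
  shows action_add: "\<alpha> g (x + y) = \<alpha> g x + \<alpha> g y"
    and action_mult: "\<alpha> g (x * y) = \<alpha> g x * \<alpha> g y"
    and action_scaleC: "\<alpha> g (c *\<^sub>C x) = c *\<^sub>C \<alpha> g x"
    and action_one: "\<alpha> g 1 = 1"
  using dynamical by (auto simp: dynamical_system_def algebra_automorphism_def)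

lemma action_scaleR: "\<alpha> g (r *\<^sub>R x) = r *\<^sub>R \<alpha> g x"
  using action_scaleC[of g "complex_of_real r" x] by (simp add: scaleC_of_real)

lemma linear_action: "linear (\<alpha> g)"
  by (intro linearI action_add action_scaleR)

lemma action_zero: "\<alpha> 0 x = x"
proof -
  have "\<alpha> 0 (\<alpha> 0 x) = \<alpha> 0 x"
    using action_plus[of 0 0 x] by simp
  moreover have "inj (\<alpha> 0)"
    using dynamical by (simp add: dynamical_system_def algebra_automorphism_def bij_is_inj)
  ultimately show ?thesis
    by (simp add: inj_eq)
qed

lemma action_minus_cancel: "\<alpha> (- g) (\<alpha> g x) = x"
  by (simp add: action_plus[symmetric] action_zero)

lemma fixed_point_iff: "b \<in> fixed_point_algebra \<alpha> \<longleftrightarrow> (\<forall>g. \<alpha> g b = b)"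
  by (simp add: fixed_point_algebra_def)

lemma continuous_on_action [continuous_intros]:
  assumes "continuous_on S f" "continuous_on S u"
  shows "continuous_on S (\<lambda>y. \<alpha> (f y) (u y))"
proof -
  have "continuous_on UNIV (\<lambda>(g, a). \<alpha> g a)"
    using dynamical by (simp add: dynamical_system_def)
  from continuous_on_compose2[OF this continuous_on_Pair[OF assms]] show ?thesis
    by simp
qed

definition invariant_seminorm :: "('a \<Rightarrow> real) \<Rightarrow> bool"
  where "invariant_seminorm p \<longleftrightarrow>
    seminorm p \<and> (p \<longlongrightarrow> 0) (nhds 0) \<and> (\<forall>g x. p (\<alpha> g x) = p x)"

lemma invariant_seminormD:
  assumes "invariant_seminorm p"
  shows "seminorm p" "(p \<longlongrightarrow> 0) (nhds 0)" "p (\<alpha> g x) = p x"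
  using assms by (auto simp: invariant_seminorm_def)

lemma invariant_seminorm_action_diff:
  assumes "invariant_seminorm p"
  shows "p (\<alpha> g x - \<alpha> g y) = p (x - y)"
  using invariant_seminormD(3)[OF assms, of g "x - y"] linear_diff[OF linear_action, of g x y] by simp

text \<open>By compactness of the group (tube lemma), the points whose whole orbit stays in a convex symmetric
  neighbourhood \<open>V\<close> still form a neighbourhood of \<open>0\<close>. Its gauge is invariant.\<close>
lemma invariant_seminorm_inside:
  assumes "open U" "0 \<in> U"
  obtains p where "invariant_seminorm p" "\<And>x. p x < 1 \<Longrightarrow> x \<in> U"
proof -
  obtain V where V: "open V" "V \<subseteq> U" "absorbing_disc V"
    using symmetric_convex_neighbourhood[OF assms] .
  interpret V: absorbing_disc V by fact
  define W where "W = (\<Inter>g. \<alpha> g -` V)"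
  let ?f = "\<lambda>z. \<alpha> (snd z) (fst z)"
  have op: "open (?f -` V)"
    by (intro open_vimage V(1) continuous_intros)
  have sub: "{0} \<times> UNIV \<subseteq> ?f -` V"
    using V.zero_mem linear_0[OF linear_action] by auto
  obtain X where X: "0 \<in> X" "open X" "X \<times> UNIV \<subseteq> ?f -` V"
    using Elementary_Topology.tube_lemma[OF compact_group op sub] by blast
  then have "X \<subseteq> W"
    by (auto simp: W_def)
  then have "\<forall>\<^sub>F x in nhds 0. x \<in> W"
    using X eventually_nhds by blast
  moreover have "convex W"
    unfolding W_def by (intro convex_INT convex_linear_vimage linear_action V.convex)
  moreover have "- x \<in> W" if "x \<in> W" for x
    using that V.uminus_mem linear_neg[OF linear_action] by (auto simp: W_def)
  ultimately interpret W: absorbing_disc W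
    by unfold_locales
  have W_action: "\<alpha> g x \<in> W \<longleftrightarrow> x \<in> W" for g x
  proof
    assume "\<alpha> g x \<in> W"
    have "\<alpha> h x \<in> V" for h
    proof -
      have "\<alpha> (h + - g) (\<alpha> g x) \<in> V"
        using \<open>\<alpha> g x \<in> W\<close> unfolding W_def by blast
      then show "\<alpha> h x \<in> V"
        by (simp only: action_plus action_minus_cancel)
    qed
    then show "x \<in> W"
      by (simp add: W_def)
  qed (auto simp: W_def action_plus[symmetric])
  have "gauge_of W (\<alpha> g x) = gauge_of W x" for g x
    using W_action[of g] by (simp add: gauge_of_def flip: action_scaleR)
  then have "invariant_seminorm (gauge_of W)"
    by (simp add: invariant_seminorm_def W.seminorm_gauge W.tendsto_gauge)
  moreover have "W \<subseteq> U"
  proof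
    fix x assume "x \<in> W"
    then have "\<alpha> 0 x \<in> V"
      unfolding W_def by blast
    then show "x \<in> U"
      using V(2) by (auto simp: action_zero)
  qed
  then have "x \<in> U" if "gauge_of W x < 1" for x
    using W.mem_if_gauge_less_1[OF that] by blast
  ultimately show ?thesis
    by (rule that)
qed

lemma eq_if_invariant_seminorms_small:
  assumes "\<And>p e. invariant_seminorm p \<Longrightarrow> 0 < e \<Longrightarrow> p (x - y) \<le> e"
  shows "x = y"
proof (rule ccontr)
  assume "x \<noteq> y"
  then have "open (- {x - y})" "0 \<in> - {x - y}"
    by auto
  then obtain p where p: "invariant_seminorm p" "\<And>z. p z < 1 \<Longrightarrow> z \<in> - {x - y}"
    using invariant_seminorm_inside by blast
  from p(2)[of "x - y"] assms[OF p(1), of "1/2"] show False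
    by simp
qed

lemma invariant_seminorm_add:
  assumes "invariant_seminorm p" "invariant_seminorm q"
  shows "invariant_seminorm (\<lambda>x. p x + q x)"
  unfolding invariant_seminorm_def seminorm_def
proof (intro conjI allI)
  note D = assms[THEN invariant_seminormD(1)]
  show "p (x + y) + q (x + y) \<le> p x + q x + (p y + q y)" for x y
    using D[THEN seminorm_triangle, of x y] by linarith
  show "p (r *\<^sub>R x) + q (r *\<^sub>R x) = \<bar>r\<bar> * (p x + q x)" for r x
    by (simp add: D[THEN seminorm_scaleR] distrib_left)
  show "((\<lambda>x. p x + q x) \<longlongrightarrow> 0) (nhds 0)"
    using tendsto_add[OF assms[THEN invariant_seminormD(2)]] by simp
qed (simp add: assms[THEN invariant_seminormD(3)])

text \<open>Multiplication by a fixed point commutes with the action. Applied to this seminorm, the approximation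
  of the mean of \<open>a\<close> becomes an approximation of the mean of \<open>a * b\<close>.\<close>
lemma invariant_seminorm_mult:
  assumes "invariant_seminorm p" "b \<in> fixed_point_algebra \<alpha>"
  shows "invariant_seminorm (\<lambda>x. p (x * b))"
proof -
  have "((\<lambda>x. x * b) \<longlongrightarrow> 0 * b) (nhds (0 :: 'a))"
    by (intro tendsto_mult filterlim_ident tendsto_const)
  then have "((\<lambda>x. p (x * b)) \<longlongrightarrow> 0) (nhds 0)"
    using filterlim_compose[OF invariant_seminormD(2)[OF assms(1)]] by simp
  moreover have "p (\<alpha> g x * b) = p (x * b)" for g x
    using assms invariant_seminormD(3)[of p g "x * b"] by (simp add: action_mult fixed_point_iff)
  ultimately show ?thesis
    using invariant_seminormD(1)[OF assms(1)]
    by (simp add: invariant_seminorm_def seminorm_def distrib_right)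
qed

section \<open>Averages over finite sets of group elements\<close>

text \<open>This subset of the convex hull of the operators \<open>\<alpha> g\<close> contains all averages that the
  construction of the mean produces, and it makes closure under composition immediate.\<close>
inductive_set averages :: "('a \<Rightarrow> 'a) set"
  where finite_average: "finite H \<Longrightarrow> H \<noteq> {} \<Longrightarrow> (\<lambda>x. average (\<lambda>h. \<alpha> h x) H) \<in> averages"
  | compose: "T \<in> averages \<Longrightarrow> T' \<in> averages \<Longrightarrow> T \<circ> T' \<in> averages"

lemma action_in_averages: "\<alpha> g \<in> averages"
  using averages.finite_average[of "{g}"] by (simp add: average_def)

lemma id_in_averages: "id \<in> averages"
proof -
  have "\<alpha> 0 = id"
    by (rule ext) (simp add: action_zero)
  then show ?thesis
    using action_in_averages[of 0] by simp
qed

lemma linear_averages: "T \<in> averages \<Longrightarrow> linear T"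
proof (induction rule: averages.induct)
  case (finite_average H)
  show ?case
    by (intro linearI) (simp_all add: average_def action_add action_scaleR sum.distrib
        scaleR_add_right scaleR_sum_right mult.commute)
qed (rule linear_compose)

lemma averages_mult_fixed:
  "T \<in> averages \<Longrightarrow> b \<in> fixed_point_algebra \<alpha> \<Longrightarrow> T (x * b) = T x * b"
  by (induction arbitrary: x rule: averages.induct)
    (simp_all add: average_def action_mult fixed_point_iff sum_distrib_right)

lemma averages_fixed:
  assumes "T \<in> averages" "b \<in> fixed_point_algebra \<alpha>"
  shows "T b = b"
proof -
  have "T 1 = 1"
    using assms(1) by induction (simp_all add: average_def action_one sum_constant_scaleR del: sum_constant)
  then show ?thesis
    using averages_mult_fixed[OF assms, of 1] by simp
qed

text \<open>The point \<open>T x\<close> lies in the convex hull of the orbit of \<open>x\<close>, so a ball around \<open>c\<close>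
  that contains the image of the orbit under a linear map also contains the image of \<open>T x\<close>.\<close>
lemma averages_in_hull:
  assumes "T \<in> averages" "seminorm p" "linear S" "\<And>g. p (S (\<alpha> g x) - c) \<le> e"
  shows "p (S (T x) - c) \<le> e"
  using assms(1,3,4)
proof (induction arbitrary: S x rule: averages.induct)
  case (finite_average H)
  then show ?case
    by (simp add: linear_average average_diff_const seminorm_average_le[OF assms(2)])
next
  case (compose T T')
  have "p ((S \<circ> T) (\<alpha> g x) - c) \<le> e" for g
    using compose.IH(1)[OF compose.prems(1), of "\<alpha> g x"] compose.prems(2)
    by (simp add: action_plus[symmetric])
  then have "p ((S \<circ> T) (T' x) - c) \<le> e"
    by (rule compose.IH(2)[OF linear_compose[OF linear_averages[OF compose.hyps(1)] compose.prems(1)]])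
  then show ?case
    by simp
qed

lemma averages_nonexpansive:
  assumes "T \<in> averages" "invariant_seminorm p"
  shows "p (T x - T y) \<le> p (x - y)"
  using averages_in_hull[OF assms(1) invariant_seminormD(1)[OF assms(2)] linear_id, of "x - y" 0 "p (x - y)"]
    linear_diff[OF linear_averages[OF assms(1)], of x y] invariant_seminormD(3)[OF assms(2)]
  by simp

text \<open>The operators \<open>\<alpha> u\<close>, restricted to the orbit of \<open>a\<close>, are totally bounded with respect
  to uniform closeness: each \<open>h\<close> has a neighbourhood of operators uniformly close to \<open>\<alpha> h\<close> by
  the tube lemma, and finitely many of these neighbourhoods cover the group.\<close>
lemma finite_net_of_group:
  assumes p: "invariant_seminorm p" and "0 < e"
  obtains H where "finite H" "H \<noteq> {}"
    and "\<And>u. \<exists>h\<in>H. \<forall>g. p (\<alpha> h (\<alpha> g a) - \<alpha> u (\<alpha> g a)) \<le> e"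
proof -
  have cont_p: "continuous_on UNIV p"
    by (rule continuous_on_seminorm[OF p[THEN invariant_seminormD(1)] p[THEN invariant_seminormD(2)]])
  define near where "near h = {u. \<forall>g. p (\<alpha> h (\<alpha> g a) - \<alpha> u (\<alpha> g a)) \<le> e}" for h
  have "\<exists>X. h \<in> X \<and> open X \<and> X \<subseteq> near h" for h
  proof -
    let ?f = "\<lambda>z. p (\<alpha> h (\<alpha> (snd z) a) - \<alpha> (fst z) (\<alpha> (snd z) a))"
    have op: "open (?f -` {..<e})"
      by (intro open_vimage open_lessThan continuous_on_compose2[OF cont_p] continuous_intros subset_UNIV)
    have sub: "{h} \<times> UNIV \<subseteq> ?f -` {..<e}"
      using \<open>0 < e\<close> seminorm_zero[OF invariant_seminormD(1)[OF p]] by auto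
    obtain X where X: "h \<in> X" "open X" "X \<times> UNIV \<subseteq> ?f -` {..<e}"
      using Elementary_Topology.tube_lemma[OF compact_group op sub] by blast
    then have "X \<subseteq> near h"
      by (auto simp: near_def subset_iff less_imp_le)
    with X(1,2) show ?thesis
      by blast
  qed
  then obtain X where X: "h \<in> X h" "open (X h)" "X h \<subseteq> near h" for h
    by metis
  have "UNIV \<subseteq> (\<Union>h. X h)"
    using X(1) by auto
  from compactE_image[OF compact_group X(2) this]
  obtain H where H: "finite H" "UNIV \<subseteq> (\<Union>h\<in>H. X h)" .
  have "\<exists>h\<in>H. u \<in> near h" for u
    using H(2) X(3) by blast
  then show ?thesis
    using H by (intro that[of H]) (auto simp: near_def)
qed

section \<open>The mean over the group\<close>

lemma net_of_hull:
  assumes p: "invariant_seminorm p" and "T \<in> averages"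
    and net: "\<And>g. p (\<alpha> h (\<alpha> g a) - \<alpha> u (\<alpha> g a)) \<le> e"
  shows "p (\<alpha> h (T a) - \<alpha> u (T a)) \<le> e"
proof -
  have "linear (\<lambda>x. \<alpha> h x - \<alpha> u x)"
    by (intro linear_compose_sub linear_action)
  from averages_in_hull[OF \<open>T \<in> averages\<close> invariant_seminormD(1)[OF p] this, of a 0 e] net
  show ?thesis
    by simp
qed

text \<open>Let \<open>n\<close> be the size of the net \<open>H\<close>. Moving from \<open>g\<close> to \<open>g'\<close> on either side of
  the average \<open>T\<close> can be undone, up to \<open>e\<close>, for one summand: some element of the net is close to
  the group element \<open>u\<close> that compensates the move. So each further factor \<open>T\<close> turns a bound
  \<open>d\<close> for the oscillation into \<open>(e + (n - 1) * d) / n\<close>. The affine map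
  \<open>d \<mapsto> (e + (n - 1) * d) / n\<close> fixes \<open>e\<close> and contracts with factor
  \<open>1 - 1 / n\<close>, which gives the sequence \<open>d k\<close>. The same power of \<open>T\<close> serves both sides, since
  the new factor can be split off on the left as well as on the right.\<close>
lemma oscillation_of_iterated_average:
  assumes p: "invariant_seminorm p" and H: "finite H" "H \<noteq> {}"
    and net: "\<And>u. \<exists>h\<in>H. \<forall>g. p (\<alpha> h (\<alpha> g a) - \<alpha> u (\<alpha> g a)) \<le> e"
  defines "T \<equiv> \<lambda>x. average (\<lambda>h. \<alpha> h x) H"
    and "d \<equiv> \<lambda>k::nat. e + (1 - 1 / real (card H)) ^ k * (2 * p a)"
  shows "T ^^ k \<in> averages"
    and "p (\<alpha> g ((T ^^ k) a) - \<alpha> g' ((T ^^ k) a)) \<le> d k"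
    and "p ((T ^^ k) (\<alpha> g a) - (T ^^ k) (\<alpha> g' a)) \<le> d k"
proof -
  note sp = invariant_seminormD(1)[OF p]
  obtain h1 where h1: "h1 \<in> H"
    using H by blast
  have n: "real (card H) > 0"
    using H by (simp add: card_gt_0_iff)
  have "0 \<le> e"
    using net[of 0] seminorm_nonneg[OF sp] order_trans by blast
  have T: "T \<in> averages"
    unfolding T_def by (rule averages.finite_average[OF H])
  have Tx: "T x = average (\<lambda>h. \<alpha> h x) H" for x
    by (simp add: T_def)
  have Tk: "T ^^ k \<in> averages" for k
    by (induction k) (simp_all only: funpow.simps id_in_averages averages.compose[OF T])
  have step: "(e + (real (card H) - 1) * d k) / real (card H) = d (Suc k)" for k
    using n by (simp add: d_def field_simps)
  have base: "p (\<alpha> g a - \<alpha> g' a) \<le> d 0" for g g'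
    using seminorm_triangle[OF sp, of "\<alpha> g a" "- \<alpha> g' a"] \<open>0 \<le> e\<close>
    by (simp add: seminorm_minus[OF sp] invariant_seminormD(3)[OF p] d_def)
  have right: "p (\<alpha> g ((T ^^ k) a) - \<alpha> g' ((T ^^ k) a)) \<le> d k" for g g'
  proof (induction k arbitrary: g g')
    case 0
    then show ?case
      using base by simp
  next
    case (Suc k)
    define y where "y = (T ^^ k) a"
    define u where "u = - g' + (g + h1)"
    obtain h' where h': "h' \<in> H" "\<And>g. p (\<alpha> h' (\<alpha> g a) - \<alpha> u (\<alpha> g a)) \<le> e"
      using net[of u] by blast
    \<comment> \<open>The choice of \<open>u\<close> makes the summand of \<open>h1\<close> at \<open>g\<close> the would-be summand of \<open>u\<close> at \<open>g'\<close>.\<close>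
    have "\<alpha> g (\<alpha> h1 y) = \<alpha> g' (\<alpha> u y)"
      by (simp add: action_plus[symmetric] u_def add.assoc[symmetric])
    then have close: "p (\<alpha> g (\<alpha> h1 y) - \<alpha> g' (\<alpha> h' y)) \<le> e"
      using net_of_hull[OF p Tk h'(2), of k]
      by (simp add: invariant_seminorm_action_diff[OF p] seminorm_commute[OF sp, of "\<alpha> u y"] flip: y_def)
    have "p (\<alpha> g (\<alpha> h y) - \<alpha> g' (\<alpha> h'' y)) \<le> d k" for h h''
      using Suc.IH[of "g + h" "g' + h''"] by (simp add: action_plus y_def)
    from seminorm_average_diff_le[OF sp H(1) h1 h'(1),
        of "\<lambda>h. \<alpha> g (\<alpha> h y)" "\<lambda>h. \<alpha> g' (\<alpha> h y)", OF close this]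
    have "p (\<alpha> g (T y) - \<alpha> g' (T y)) \<le> d (Suc k)"
      unfolding step by (simp only: Tx linear_average[OF linear_action])
    then show ?case
      by (simp add: y_def)
  qed
  have left: "p ((T ^^ k) (\<alpha> g a) - (T ^^ k) (\<alpha> g' a)) \<le> d k" for g g'
  proof (induction k arbitrary: g g')
    case 0
    then show ?case
      using base by simp
  next
    case (Suc k)
    define u where "u = h1 + g - g'"
    obtain h' where h': "h' \<in> H" "\<And>g. p (\<alpha> h' (\<alpha> g a) - \<alpha> u (\<alpha> g a)) \<le> e"
      using net[of u] by blast
    have "\<alpha> h1 (\<alpha> g a) = \<alpha> u (\<alpha> g' a)"
      by (simp add: action_plus[symmetric] u_def)
    then have "p (\<alpha> h1 (\<alpha> g a) - \<alpha> h' (\<alpha> g' a)) \<le> e"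
      using h'(2)[of g'] by (simp add: seminorm_commute[OF sp, of "\<alpha> u _"])
    then have close: "p ((T ^^ k) (\<alpha> h1 (\<alpha> g a)) - (T ^^ k) (\<alpha> h' (\<alpha> g' a))) \<le> e"
      using averages_nonexpansive[OF Tk p] order_trans by blast
    have "p ((T ^^ k) (\<alpha> h (\<alpha> g a)) - (T ^^ k) (\<alpha> h'' (\<alpha> g' a))) \<le> d k" for h h''
      using Suc.IH[of "h + g" "h'' + g'"] by (simp add: action_plus)
    from seminorm_average_diff_le[OF sp H(1) h1 h'(1),
        of "\<lambda>h. (T ^^ k) (\<alpha> h (\<alpha> g a))" "\<lambda>h. (T ^^ k) (\<alpha> h (\<alpha> g' a))", OF close this]
    have "p ((T ^^ k) (T (\<alpha> g a)) - (T ^^ k) (T (\<alpha> g' a))) \<le> d (Suc k)"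
      unfolding step by (simp only: Tx linear_average[OF linear_averages[OF Tk]])
    then show ?case
      by (simp add: funpow_Suc_right del: funpow.simps)
  qed
  show "T ^^ k \<in> averages" "p (\<alpha> g ((T ^^ k) a) - \<alpha> g' ((T ^^ k) a)) \<le> d k"
    "p ((T ^^ k) (\<alpha> g a) - (T ^^ k) (\<alpha> g' a)) \<le> d k"
    by (rule Tk right left)+
qed

text \<open>The first condition makes the point almost fixed, the second one makes it almost independent of
  the choice of \<open>T\<close>; uniqueness of the limit rests on having both.\<close>
definition approximate_means :: "'a \<Rightarrow> ('a \<Rightarrow> real) \<Rightarrow> real \<Rightarrow> 'a set"
  where "approximate_means a p e = {T a | T. T \<in> averages \<and>
    (\<forall>g. p (\<alpha> g (T a) - T a) \<le> e) \<and> (\<forall>g. p (T (\<alpha> g a) - T a) \<le> e)}"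

lemma approximate_means_mono:
  assumes "\<And>x. p x \<le> q x" "d \<le> e"
  shows "approximate_means a q d \<subseteq> approximate_means a p e"
proof -
  have "p x \<le> e" if "q x \<le> d" for x
    using that assms(1)[of x] assms(2) by linarith
  then show ?thesis
    unfolding approximate_means_def by blast
qed

lemma approximate_means_nonempty:
  assumes p: "invariant_seminorm p" and "0 < e"
  shows "approximate_means a p e \<noteq> {}"
proof -
  obtain H where H: "finite H" "H \<noteq> {}"
    and net: "\<And>u. \<exists>h\<in>H. \<forall>g. p (\<alpha> h (\<alpha> g a) - \<alpha> u (\<alpha> g a)) \<le> e / 2"
    using finite_net_of_group[OF p, of "e / 2"] \<open>0 < e\<close> by auto
  \<comment> \<open>The summand \<open>1\<close> keeps the divisor positive when \<open>p a = 0\<close>.\<close>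
  define D where "D = 2 * p a + 1"
  have "0 < D"
    using seminorm_nonneg[OF invariant_seminormD(1)[OF p], of a] by (simp add: D_def)
  define q where "q = 1 - 1 / real (card H)"
  have q: "0 \<le> q" "q < 1"
    using H by (auto simp: q_def card_gt_0_iff Suc_le_eq)
  obtain k where "q ^ k < e / 2 / D"
    using real_arch_pow_inv[OF _ q(2), of "e / 2 / D"] \<open>0 < D\<close> \<open>0 < e\<close> by auto
  then have "q ^ k * D < e / 2"
    using \<open>0 < D\<close> by (simp add: pos_less_divide_eq)
  moreover have "q ^ k * (2 * p a) \<le> q ^ k * D"
    using q(1) by (intro mult_left_mono) (auto simp: D_def)
  ultimately have small: "e / 2 + q ^ k * (2 * p a) \<le> e"
    by simp
  define T where "T = (\<lambda>x. average (\<lambda>h. \<alpha> h x) H)"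
  note osc = oscillation_of_iterated_average[OF p H net, where k = k, folded T_def q_def]
  have "p (\<alpha> g ((T ^^ k) a) - (T ^^ k) a) \<le> e" for g
    using order_trans[OF osc(2)[of g 0] small] by (simp add: action_zero)
  moreover have "p ((T ^^ k) (\<alpha> g a) - (T ^^ k) a) \<le> e" for g
    using order_trans[OF osc(3)[of g 0] small] by (simp add: action_zero)
  ultimately show ?thesis
    unfolding approximate_means_def using osc(1) by blast
qed

text \<open>Write \<open>x = T a\<close> and \<open>y = T' a\<close>. Since \<open>T' a\<close> is in the convex hull of the orbit of
  \<open>a\<close>, on which \<open>T\<close> is almost constant, \<open>T (T' a)\<close> is close to \<open>T a\<close>. Since
  \<open>T (T' a)\<close> is in the convex hull of the orbit of the almost fixed point \<open>T' a\<close>, it is also close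
  to \<open>T' a\<close>.\<close>
lemma approximate_means_close:
  assumes sp: "seminorm p" and "x \<in> approximate_means a p e" "y \<in> approximate_means a p e"
  shows "p (x - y) \<le> 2 * e"
proof -
  obtain T where T: "x = T a" "T \<in> averages" "\<And>g. p (T (\<alpha> g a) - T a) \<le> e"
    using assms(2) by (auto simp: approximate_means_def)
  obtain T' where T': "y = T' a" "T' \<in> averages" "\<And>g. p (\<alpha> g (T' a) - T' a) \<le> e"
    using assms(3) by (auto simp: approximate_means_def)
  have "p (T (T' a) - T a) \<le> e"
    by (rule averages_in_hull[OF T'(2) sp linear_averages[OF T(2)] T(3)])
  moreover have "p (id (T (T' a)) - T' a) \<le> e"
    by (rule averages_in_hull[OF T(2) sp linear_id]) (simp add: T'(3))
  ultimately show ?thesis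
    using seminorm_triangle_diff[OF sp, of "T a" "T' a" "T (T' a)"]
      seminorm_commute[OF sp, of "T a" "T (T' a)"]
    by (simp add: T(1) T'(1))
qed

text \<open>Averages that approximate \<open>c\<close> uniformly on the orbit of \<open>a\<close> characterise the mean, and this
  one-sided form is enough for uniqueness and additivity.\<close>
definition is_mean :: "'a \<Rightarrow> 'a \<Rightarrow> bool"
  where "is_mean a c \<longleftrightarrow> c \<in> fixed_point_algebra \<alpha> \<and>
    (\<forall>p e. invariant_seminorm p \<longrightarrow> 0 < e \<longrightarrow> (\<exists>T\<in>averages. \<forall>g. p (T (\<alpha> g a) - c) \<le> e))"

text \<open>The sets of approximate means are nonempty, decrease as the seminorm grows and the tolerance shrinks,
  and have small diameter, so they generate a Cauchy filter.\<close>
lemma approximate_means_converge: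
  assumes complete: "complete (UNIV :: 'a set)"
  obtains c where "\<And>p e. invariant_seminorm p \<Longrightarrow> 0 < e \<Longrightarrow> \<exists>y\<in>approximate_means a p e. p (y - c) \<le> e"
proof -
  define I where "I = {(p, e :: real). invariant_seminorm p \<and> 0 < e}"
  define C where "C = (\<lambda>(p, e). approximate_means a p e)"
  define F where "F = (INF i\<in>I. principal (C i))"
  have "invariant_seminorm (\<lambda>x. 0)"
    by (simp add: invariant_seminorm_def seminorm_def)
  then have "((\<lambda>x. 0), 1) \<in> I"
    by (simp add: I_def)
  then have "I \<noteq> {}"
    by blast
  have directed: "\<exists>k\<in>I. principal (C k) \<le> inf (principal (C i)) (principal (C j))"
    if "i \<in> I" "j \<in> I" for i j
  proof -
    obtain p e q f where ij: "i = (p, e)" "j = (q, f)"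
      by (cases i, cases j)
    then have pq: "invariant_seminorm p" "invariant_seminorm q" "0 < e" "0 < f"
      using that by (auto simp: I_def)
    have "approximate_means a (\<lambda>x. p x + q x) (min e f) \<subseteq> approximate_means a p e"
         "approximate_means a (\<lambda>x. p x + q x) (min e f) \<subseteq> approximate_means a q f"
      using seminorm_nonneg[OF invariant_seminormD(1)[OF pq(1)]]
        seminorm_nonneg[OF invariant_seminormD(1)[OF pq(2)]]
      by (intro approximate_means_mono; simp)+
    then have "principal (C ((\<lambda>x. p x + q x), min e f)) \<le> inf (principal (C i)) (principal (C j))"
      by (simp add: C_def ij)
    moreover have "((\<lambda>x. p x + q x), min e f) \<in> I"
      using pq by (simp add: I_def invariant_seminorm_add)
    ultimately show ?thesis
      by blast
  qed
  have ev: "eventually P F \<longleftrightarrow> (\<exists>i\<in>I. \<forall>x\<in>C i. P x)" for P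
    unfolding F_def by (subst eventually_INF_base[OF \<open>I \<noteq> {}\<close> directed]) (simp_all add: eventually_principal)
  have "F \<noteq> bot"
  proof
    assume "F = bot"
    then have "eventually (\<lambda>x. False) F"
      by simp
    then show False
      unfolding ev using approximate_means_nonempty by (auto simp: I_def C_def)
  qed
  moreover have "cauchy_filter F"
    unfolding cauchy_filter_def
  proof (rule filter_leI)
    fix P :: "'a \<times> 'a \<Rightarrow> bool"
    assume "eventually P uniformity"
    then obtain Q where Q: "eventually Q (nhds 0)" "\<And>x y. Q (y - x) \<Longrightarrow> P (x, y)"
      unfolding uniformity_eq eventually_filtercomap by auto
    then obtain U where U: "open U" "0 \<in> U" "\<And>z. z \<in> U \<Longrightarrow> Q z"
      unfolding eventually_nhds by blast
    obtain p where p: "invariant_seminorm p" "\<And>z. p z < 1 \<Longrightarrow> z \<in> U"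
      using invariant_seminorm_inside[OF U(1,2)] by blast
    \<comment> \<open>Approximate means differ by at most twice their tolerance; \<open>1/4\<close> keeps this below \<open>1\<close>.\<close>
    have "P (x, y)" if xy: "x \<in> approximate_means a p (1/4)" "y \<in> approximate_means a p (1/4)" for x y
    proof -
      have "p (y - x) \<le> 2 * (1 / 4)"
        by (rule approximate_means_close[OF invariant_seminormD(1)[OF p(1)] xy(2,1)])
      then have "p (y - x) < 1"
        by simp
      then show ?thesis
        by (intro Q U p)
    qed
    moreover have "eventually (\<lambda>x. x \<in> approximate_means a p (1/4)) F"
      unfolding ev using p(1) by (intro bexI[of _ "(p, 1/4)"]) (auto simp: I_def C_def)
    ultimately show "eventually P (F \<times>\<^sub>F F)"
      unfolding eventually_prod_filter by blast
  qed
  moreover have "F \<le> principal UNIV"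
    by simp
  ultimately obtain c where c: "F \<le> nhds c"
    using complete unfolding complete_uniform by blast
  have "\<exists>y\<in>approximate_means a p e. p (y - c) \<le> e" if p: "invariant_seminorm p" and "0 < e" for p e
  proof -
    have "((\<lambda>y. y - c) \<longlongrightarrow> c - c) (nhds c)"
      by (intro tendsto_diff filterlim_ident tendsto_const)
    then have "((\<lambda>y. p (y - c)) \<longlongrightarrow> 0) (nhds c)"
      using filterlim_compose[OF invariant_seminormD(2)[OF p]] by simp
    then have "eventually (\<lambda>y. p (y - c) < e) F"
      using order_tendstoD(2) \<open>0 < e\<close> c filter_leD by blast
    moreover have "eventually (\<lambda>x. x \<in> approximate_means a p e) F"
      unfolding ev using that by (intro bexI[of _ "(p, e)"]) (auto simp: I_def C_def)
    ultimately have "eventually (\<lambda>y. y \<in> approximate_means a p e \<and> p (y - c) \<le> e) F"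
      by eventually_elim auto
    from eventually_happens'[OF \<open>F \<noteq> bot\<close> this] show ?thesis
      by blast
  qed
  then show ?thesis
    by (rule that)
qed

lemma mean_exists:
  assumes "complete (UNIV :: 'a set)"
  shows "\<exists>c. is_mean a c"
proof -
  obtain c where c: "\<And>p e. invariant_seminorm p \<Longrightarrow> 0 < e \<Longrightarrow> \<exists>y\<in>approximate_means a p e. p (y - c) \<le> e"
    using approximate_means_converge[OF assms] by blast
  have near: "\<exists>T\<in>averages. p (T a - c) \<le> e \<and> (\<forall>g. p (\<alpha> g (T a) - T a) \<le> e) \<and> (\<forall>g. p (T (\<alpha> g a) - T a) \<le> e)"
    if "invariant_seminorm p" "0 < e" for p e
    using c[OF that] by (auto simp: approximate_means_def)
  have "\<alpha> g c = c" for g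
  proof (rule eq_if_invariant_seminorms_small)
    fix p e assume p: "invariant_seminorm p" and "(0 :: real) < e"
    note sp = invariant_seminormD(1)[OF p]
    obtain T where T: "p (T a - c) \<le> e / 3" "p (\<alpha> g (T a) - T a) \<le> e / 3"
      using near[OF p, of "e / 3"] \<open>0 < e\<close> by auto
    have "p (\<alpha> g c - \<alpha> g (T a)) \<le> e / 3"
      using T(1) by (simp add: invariant_seminorm_action_diff[OF p] seminorm_commute[OF sp, of c])
    then show "p (\<alpha> g c - c) \<le> e"
      using T seminorm_triangle_diff[OF sp, of "\<alpha> g c" c "\<alpha> g (T a)"]
        seminorm_triangle_diff[OF sp, of "\<alpha> g (T a)" c "T a"] by simp
  qed
  moreover have "\<exists>T\<in>averages. \<forall>g. p (T (\<alpha> g a) - c) \<le> e" if p: "invariant_seminorm p" and "0 < e" for p e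
  proof -
    obtain T where T: "T \<in> averages" "p (T a - c) \<le> e / 2" "\<And>g. p (T (\<alpha> g a) - T a) \<le> e / 2"
      using near[OF p, of "e / 2"] \<open>0 < e\<close> by auto
    have "p (T (\<alpha> g a) - c) \<le> e" for g
      using T(2) T(3)[of g] seminorm_triangle_diff[OF invariant_seminormD(1)[OF p], of "T (\<alpha> g a)" c "T a"]
      by simp
    then show ?thesis
      using T(1) by blast
  qed
  ultimately show ?thesis
    unfolding is_mean_def fixed_point_iff by blast
qed

text \<open>If \<open>T\<close> works for \<open>a\<close> and \<open>T'\<close> for \<open>a'\<close>, then \<open>T \<circ> T'\<close> works for
  both: on the orbit of \<open>a\<close> because \<open>T'\<close> stays in its convex hull, on the orbit of \<open>a'\<close>
  because \<open>T\<close> does not move the fixed point \<open>c'\<close>.\<close>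
lemma is_mean_common_average:
  assumes "is_mean a c" "is_mean a' c'" "invariant_seminorm p" "0 < e"
  obtains T where "T \<in> averages" "\<And>g. p (T (\<alpha> g a) - c) \<le> e" "\<And>g. p (T (\<alpha> g a') - c') \<le> e"
proof -
  note sp = invariant_seminormD(1)[OF assms(3)]
  obtain T where T: "T \<in> averages" "\<And>g. p (T (\<alpha> g a) - c) \<le> e"
    using assms unfolding is_mean_def by blast
  obtain T' where T': "T' \<in> averages" "\<And>g. p (T' (\<alpha> g a') - c') \<le> e"
    using assms unfolding is_mean_def by blast
  have fixed: "c' \<in> fixed_point_algebra \<alpha>"
    using assms(2) by (simp add: is_mean_def)
  have 1: "p ((T \<circ> T') (\<alpha> g a) - c) \<le> e" for g
    using averages_in_hull[OF T'(1) sp linear_averages[OF T(1)], of "\<alpha> g a" c e] T(2)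
    by (simp add: action_plus[symmetric])
  have 2: "p ((T \<circ> T') (\<alpha> g a') - c') \<le> e" for g
    using averages_nonexpansive[OF T(1) assms(3), of "T' (\<alpha> g a')" c'] T'(2)[of g]
    by (simp add: averages_fixed[OF T(1) fixed])
  show ?thesis
    by (rule that[OF averages.compose[OF T(1) T'(1)] 1 2])
qed

lemma is_mean_unique:
  assumes "is_mean a c" "is_mean a c'"
  shows "c = c'"
proof (rule eq_if_invariant_seminorms_small)
  fix p e assume p: "invariant_seminorm p" and "(0 :: real) < e"
  note sp = invariant_seminormD(1)[OF p]
  obtain T where "p (T (\<alpha> 0 a) - c) \<le> e / 2" "p (T (\<alpha> 0 a) - c') \<le> e / 2"
    using is_mean_common_average[OF assms p, of "e / 2"] \<open>0 < e\<close> by (metis half_gt_zero)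
  then show "p (c - c') \<le> e"
    using seminorm_triangle_diff[OF sp, of c c' "T (\<alpha> 0 a)"] seminorm_commute[OF sp, of c] by simp
qed

lemma is_mean_add:
  assumes "is_mean a c" "is_mean a' c'"
  shows "is_mean (a + a') (c + c')"
  unfolding is_mean_def
proof (intro conjI allI impI)
  show "c + c' \<in> fixed_point_algebra \<alpha>"
    using assms by (simp add: is_mean_def fixed_point_iff action_add)
  fix p e assume p: "invariant_seminorm p" and "(0 :: real) < e"
  note sp = invariant_seminormD(1)[OF p]
  obtain T where T: "T \<in> averages" "\<And>g. p (T (\<alpha> g a) - c) \<le> e / 2" "\<And>g. p (T (\<alpha> g a') - c') \<le> e / 2"
    using is_mean_common_average[OF assms p, of "e / 2"] \<open>0 < e\<close> by auto
  have "p (T (\<alpha> g (a + a')) - (c + c')) \<le> e" for g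
    using T(2,3)[of g] seminorm_triangle[OF sp, of "T (\<alpha> g a) - c" "T (\<alpha> g a') - c'"]
    by (simp add: action_add linear_add[OF linear_averages[OF T(1)]] algebra_simps)
  then show "\<exists>T\<in>averages. \<forall>g. p (T (\<alpha> g (a + a')) - (c + c')) \<le> e"
    using T(1) by blast
qed

lemma is_mean_mult_fixed:
  assumes "is_mean a c" "b \<in> fixed_point_algebra \<alpha>"
  shows "is_mean (a * b) (c * b)"
  unfolding is_mean_def
proof (intro conjI allI impI)
  show "c * b \<in> fixed_point_algebra \<alpha>"
    using assms by (simp add: is_mean_def fixed_point_iff action_mult)
  fix p e assume p: "invariant_seminorm p" and "(0 :: real) < e"
  obtain T where T: "T \<in> averages" "\<And>g. p ((T (\<alpha> g a) - c) * b) \<le> e"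
    using assms(1) invariant_seminorm_mult[OF p assms(2)] \<open>0 < e\<close> unfolding is_mean_def by blast
  have "T (\<alpha> g (a * b)) = T (\<alpha> g a) * b" for g
    using assms(2) averages_mult_fixed[OF T(1) assms(2)] by (simp add: action_mult fixed_point_iff)
  then show "\<exists>T\<in>averages. \<forall>g. p (T (\<alpha> g (a * b)) - c * b) \<le> e"
    using T by (intro bexI[of _ T]) (simp_all add: left_diff_distrib)
qed

lemma is_mean_fixed:
  assumes "b \<in> fixed_point_algebra \<alpha>"
  shows "is_mean b b"
proof -
  have "\<exists>T\<in>averages. \<forall>g. p (T (\<alpha> g b) - b) \<le> e" if "invariant_seminorm p" "0 < e" for p e
    using assms that seminorm_zero[OF invariant_seminormD(1)[OF that(1)]]
    by (intro bexI[OF _ id_in_averages]) (simp add: fixed_point_iff)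
  then show ?thesis
    using assms by (simp add: is_mean_def)
qed

end

section \<open>The Hahn-Banach theorem\<close>

definition sublinear :: "('a::real_vector \<Rightarrow> real) \<Rightarrow> bool"
  where "sublinear q \<longleftrightarrow> (\<forall>x y. q (x + y) \<le> q x + q y) \<and> (\<forall>r>0. \<forall>x. q (r *\<^sub>R x) = r * q x)"

lemma sublinear_add: "sublinear q \<Longrightarrow> q (x + y) \<le> q x + q y"
  and sublinear_scaleR: "sublinear q \<Longrightarrow> 0 < r \<Longrightarrow> q (r *\<^sub>R x) = r * q x"
  by (auto simp: sublinear_def)

lemma sublinear_zero: "sublinear q \<Longrightarrow> q 0 = 0"
  using sublinear_scaleR[of q 2 0] by simp

lemma sublinear_minus_le: "sublinear q \<Longrightarrow> - q (- x) \<le> q x"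
  using sublinear_add[of q x "- x"] by (simp add: sublinear_zero)

text \<open>The functional \<open>x \<mapsto> inf {q (x + t y) - t q y | t \<ge> 0}\<close> lies below \<open>q\<close> and is as
  small as possible at \<open>- y\<close>. A minimal sublinear functional therefore satisfies
  \<open>q (- y) = - q y\<close>, that is, it is linear.\<close>
lemma sublinear_lower:
  assumes q: "sublinear q"
  obtains q' where "sublinear q'" "\<And>x. q' x \<le> q x" "q' (- y) \<le> - q y"
proof -
  define S where "S x = (\<lambda>t. q (x + t *\<^sub>R y) - t * q y) ` {0..}" for x
  define q' where "q' x = Inf (S x)" for x
  have scale: "q (t *\<^sub>R y) = t * q y" if "0 \<le> t" for t
    using sublinear_scaleR[OF q, of t y] sublinear_zero[OF q] that by (cases "t = 0") auto
  have lower: "- q (- x) \<le> s" if s: "s \<in> S x" for s x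
  proof -
    obtain t where t: "0 \<le> t" "s = q (x + t *\<^sub>R y) - t * q y"
      using s by (auto simp: S_def)
    show ?thesis
      using sublinear_add[OF q, of "x + t *\<^sub>R y" "- x"] scale[OF t(1)] t(2) by simp
  qed
  have bdd: "bdd_below (S x)" for x
    using lower by (rule bdd_belowI)
  have upper: "q' x \<le> q (x + t *\<^sub>R y) - t * q y" if "0 \<le> t" for x t
    unfolding q'_def using that by (intro cInf_lower bdd) (auto simp: S_def)
  have near: "\<exists>t\<ge>0. q (x + t *\<^sub>R y) - t * q y < q' x + e" if "0 < e" for x e
  proof -
    have "S x \<noteq> {}" "Inf (S x) < q' x + e"
      using that by (auto simp: S_def q'_def)
    from cInf_lessD[OF this] show ?thesis
      by (auto simp: S_def)
  qed
  have add: "q' (x + z) \<le> q' x + q' z" for x z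
  proof (rule field_le_epsilon)
    fix e :: real assume "0 < e"
    obtain s where s: "0 \<le> s" "q (x + s *\<^sub>R y) - s * q y < q' x + e / 2"
      using near[of "e / 2" x] \<open>0 < e\<close> by auto
    obtain t where t: "0 \<le> t" "q (z + t *\<^sub>R y) - t * q y < q' z + e / 2"
      using near[of "e / 2" z] \<open>0 < e\<close> by auto
    have "q' (x + z) \<le> q ((x + s *\<^sub>R y) + (z + t *\<^sub>R y)) - (s + t) * q y"
      using upper[of "s + t" "x + z"] s(1) t(1) by (simp add: algebra_simps)
    also have "\<dots> \<le> q (x + s *\<^sub>R y) - s * q y + (q (z + t *\<^sub>R y) - t * q y)"
      using sublinear_add[OF q, of "x + s *\<^sub>R y" "z + t *\<^sub>R y"] by (simp add: algebra_simps)
    finally show "q' (x + z) \<le> q' x + q' z + e"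
      using s(2) t(2) by simp
  qed
  have le: "q' (r *\<^sub>R x) \<le> r * q' x" if "0 < r" for r x
  proof (rule field_le_epsilon)
    fix e :: real assume "0 < e"
    obtain t where t: "0 \<le> t" "q (x + t *\<^sub>R y) - t * q y < q' x + e / r"
      using near[of "e / r" x] \<open>0 < e\<close> \<open>0 < r\<close> by auto
    have "q' (r *\<^sub>R x) \<le> q (r *\<^sub>R (x + t *\<^sub>R y)) - (r * t) * q y"
      using upper[of "r * t" "r *\<^sub>R x"] t(1) \<open>0 < r\<close> by (simp add: scaleR_add_right)
    also have "\<dots> = r * (q (x + t *\<^sub>R y) - t * q y)"
      by (simp add: sublinear_scaleR[OF q \<open>0 < r\<close>] right_diff_distrib)
    also have "\<dots> \<le> r * (q' x + e / r)"
      using t(2) \<open>0 < r\<close> by (intro mult_left_mono) auto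
    finally show "q' (r *\<^sub>R x) \<le> r * q' x + e"
      using \<open>0 < r\<close> by (simp add: distrib_left)
  qed
  have "q' (r *\<^sub>R x) = r * q' x" if "0 < r" for r x
  proof (rule antisym[OF le[OF that]])
    have "q' x \<le> inverse r * q' (r *\<^sub>R x)"
      using le[of "inverse r" "r *\<^sub>R x"] that by simp
    then show "r * q' x \<le> q' (r *\<^sub>R x)"
      using that by (simp add: field_simps)
  qed
  with add have "sublinear q'"
    by (simp add: sublinear_def)
  moreover have "q' x \<le> q x" for x
    using upper[of 0 x] by simp
  moreover have "q' (- y) \<le> - q y"
    using upper[of 1 "- y"] sublinear_zero[OF q] by simp
  ultimately show ?thesis
    by (rule that)
qed

lemma sublinear_INF:
  assumes "C \<noteq> {}" and sub: "\<And>q. q \<in> C \<Longrightarrow> sublinear q"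
    and chain: "\<And>q q'. q \<in> C \<Longrightarrow> q' \<in> C \<Longrightarrow> (\<forall>x. q x \<le> q' x) \<or> (\<forall>x. q' x \<le> q x)"
    and below: "\<forall>q\<in>C. \<forall>x. q x \<le> p x"
  shows "sublinear (\<lambda>x. INF q\<in>C. q x)" and "\<And>q x. q \<in> C \<Longrightarrow> (INF q\<in>C. q x) \<le> q x"
proof -
  have bdd: "bdd_below ((\<lambda>q. q x) ` C)" for x
  proof (rule bdd_belowI2)
    fix q assume "q \<in> C"
    then show "- p (- x) \<le> q x"
      using sublinear_minus_le[OF sub, of q x] below \<open>q \<in> C\<close> by (smt (verit))
  qed
  show lower: "(INF q\<in>C. q x) \<le> q x" if "q \<in> C" for q x
    using that by (intro cINF_lower bdd)
  let ?m = "\<lambda>x. INF q\<in>C. q x"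
  have near: "\<exists>q\<in>C. q x < ?m x + e" if "0 < e" for x e
    using cINF_less_iff[OF \<open>C \<noteq> {}\<close> bdd, of x "?m x + e"] that by simp
  have "?m (x + y) \<le> ?m x + ?m y" for x y
  proof (rule field_le_epsilon)
    fix e :: real assume "0 < e"
    obtain q where q: "q \<in> C" "q x < ?m x + e / 2"
      using near[of "e / 2" x] \<open>0 < e\<close> by auto
    obtain q' where q': "q' \<in> C" "q' y < ?m y + e / 2"
      using near[of "e / 2" y] \<open>0 < e\<close> by auto
    have "\<exists>r\<in>C. r x \<le> q x \<and> r y \<le> q' y"
      using chain[OF q(1) q'(1)] q(1) q'(1) by auto
    then obtain r where r: "r \<in> C" "r x \<le> q x" "r y \<le> q' y"
      by blast
    show "?m (x + y) \<le> ?m x + ?m y + e"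
      using lower[OF r(1), of "x + y"] sublinear_add[OF sub[OF r(1)], of x y] r q q' by simp
  qed
  moreover have le: "?m (r *\<^sub>R x) \<le> r * ?m x" if "0 < r" for r x
  proof (rule field_le_epsilon)
    fix e :: real assume "0 < e"
    obtain q where q: "q \<in> C" "q x < ?m x + e / r"
      using near[of "e / r" x] \<open>0 < e\<close> \<open>0 < r\<close> by auto
    have "?m (r *\<^sub>R x) \<le> r * q x"
      using lower[OF q(1), of "r *\<^sub>R x"] sublinear_scaleR[OF sub[OF q(1)] that] by simp
    also have "\<dots> \<le> r * (?m x + e / r)"
      using q(2) that by (intro mult_left_mono) auto
    finally show "?m (r *\<^sub>R x) \<le> r * ?m x + e"
      using that by (simp add: distrib_left)
  qed
  moreover have "r * ?m x \<le> ?m (r *\<^sub>R x)" if "0 < r" for r x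
  proof -
    have "?m x \<le> inverse r * ?m (r *\<^sub>R x)"
      using le[of "inverse r" "r *\<^sub>R x"] that by simp
    then show ?thesis
      using that by (simp add: field_simps)
  qed
  ultimately show "sublinear ?m"
    unfolding sublinear_def by (auto intro: antisym)
qed

text \<open>A minimal sublinear functional below \<open>p\<close> is linear. To get the prescribed value at \<open>y\<close>, the
  minimal one is chosen below the functional \<open>p'\<close> with \<open>p' (- y) \<le> - p y\<close>. Working with
  functionals defined everywhere avoids extensions from subspaces.\<close>
theorem linear_functional_below_sublinear:
  assumes p: "sublinear p"
  obtains f where "linear f" "\<And>x. f x \<le> p x" "f y = p y"
proof -
  obtain p' where p': "sublinear p'" "\<And>x. p' x \<le> p x" "p' (- y) \<le> - p y"
    using sublinear_lower[OF p] by blast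
  define A where "A = {q. sublinear q \<and> (\<forall>x. q x \<le> p' x)}"
  define P where "P = (\<lambda>q q' :: 'a \<Rightarrow> real. \<forall>x. q' x \<le> q x)"
  have "partial_order_on A (relation_of P A)"
    by (rule partial_order_on_relation_ofI) (auto simp: P_def fun_eq_iff intro: order_trans antisym)
  moreover have "\<exists>u\<in>A. \<forall>q\<in>C. P q u" if C: "C \<in> Chains (relation_of P A)" for C
  proof (cases "C = {}")
    case True
    then show ?thesis
      using p'(1) by (auto simp: A_def)
  next
    case False
    have CA: "C \<subseteq> A"
      by (rule Chains_relation_of[OF C])
    have sub: "sublinear q" "\<And>x. q x \<le> p' x" if "q \<in> C" for q
      using that CA by (auto simp: A_def)
    have chain: "(\<forall>x. q x \<le> q' x) \<or> (\<forall>x. q' x \<le> q x)" if "q \<in> C" "q' \<in> C" for q q'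
      using C that unfolding Chains_def relation_of_def P_def by blast
    have "\<forall>q\<in>C. \<forall>x. q x \<le> p' x"
      using sub(2) by blast
    note INF = sublinear_INF[OF False sub(1) chain this]
    obtain q where "q \<in> C"
      using False by blast
    then have "(INF q\<in>C. q x) \<le> p' x" for x
      using INF(2)[of q x] sub(2)[of q x] by linarith
    with INF(1) have "(\<lambda>x. INF q\<in>C. q x) \<in> A"
      unfolding A_def by blast
    moreover have "\<forall>q\<in>C. P q (\<lambda>x. INF q\<in>C. q x)"
      unfolding P_def using INF(2) by blast
    ultimately show ?thesis
      by blast
  qed
  ultimately obtain f where f: "f \<in> A" "\<And>q. q \<in> A \<Longrightarrow> P f q \<Longrightarrow> q = f"
    using predicate_Zorn[of A P] by blast
  have sf: "sublinear f" and fp: "\<And>x. f x \<le> p' x"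
    using f(1) by (auto simp: A_def)
  have minus: "f (- x) = - f x" for x
  proof -
    obtain q where q: "sublinear q" "\<And>z. q z \<le> f z" "q (- x) \<le> - f x"
      using sublinear_lower[OF sf] by blast
    have "q z \<le> p' z" for z
      using q(2)[of z] fp[of z] by linarith
    then have "q = f"
      using q by (intro f(2)) (auto simp: A_def P_def)
    then show ?thesis
      using q(3) sublinear_minus_le[OF sf, of x] by simp
  qed
  have "f (x + z) = f x + f z" for x z
    using sublinear_add[OF sf, of x z] sublinear_add[OF sf, of "- x" "- z"] minus[of "x + z"]
    by (simp add: minus)
  moreover have "f (r *\<^sub>R x) = r *\<^sub>R f x" for r x
    using sublinear_scaleR[OF sf, of r x] sublinear_scaleR[OF sf, of "- r" x] minus[of "r *\<^sub>R x"]
    by (cases r "0 :: real" rule: linorder_cases) (auto simp: sublinear_zero[OF sf])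
  ultimately have "linear f"
    by (rule linearI)
  moreover have "f x \<le> p x" for x
    using fp[of x] p'(2)[of x] by linarith
  moreover have "f y = p y"
    using fp[of "- y"] p'(3) minus[of y] calculation(2)[of y] by linarith
  ultimately show ?thesis
    by (rule that)
qed

section \<open>Ideals\<close>

definition ideal_set :: "'a::comm_ring_1 set \<Rightarrow> bool"
  where "ideal_set J \<longleftrightarrow> 0 \<in> J \<and> (\<forall>x\<in>J. \<forall>y\<in>J. x + y \<in> J) \<and> (\<forall>a. \<forall>x\<in>J. a * x \<in> J)"

lemma ideal_setD:
  assumes "ideal_set J"
  shows "0 \<in> J" "x \<in> J \<Longrightarrow> y \<in> J \<Longrightarrow> x + y \<in> J" "x \<in> J \<Longrightarrow> a * x \<in> J"
  using assms by (auto simp: ideal_set_def)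

lemma ideal_set_diff:
  assumes "ideal_set J" "x \<in> J" "y \<in> J"
  shows "x - y \<in> J"
  using ideal_setD(2)[OF assms(1,2) ideal_setD(3)[OF assms(1,3), of "- 1"]] by simp

lemma maximal_ideal_exists:
  fixes J :: "'a::comm_ring_1 set"
  assumes "ideal_set J" "1 \<notin> J"
  obtains M where "ideal_set M" "1 \<notin> M" "J \<subseteq> M" "\<And>x. x \<notin> M \<Longrightarrow> \<exists>r. r * x - 1 \<in> M"
proof -
  define \<A> where "\<A> = {K. ideal_set K \<and> 1 \<notin> K \<and> J \<subseteq> K}"
  have "\<Union>\<C> \<in> \<A>" if \<C>: "\<C> \<noteq> {}" "subset.chain \<A> \<C>" for \<C>
  proof -
    have ideals: "ideal_set K" "1 \<notin> K" "J \<subseteq> K" if "K \<in> \<C>" for K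
      using \<C>(2) that by (auto simp: subset_chain_def \<A>_def)
    have "x + y \<in> \<Union>\<C>" if xy: "x \<in> \<Union>\<C>" "y \<in> \<Union>\<C>" for x y
    proof -
      obtain K L where KL: "K \<in> \<C>" "x \<in> K" "L \<in> \<C>" "y \<in> L"
        using xy by blast
      then have "K \<subseteq> L \<or> L \<subseteq> K"
        using \<C>(2) by (auto simp: subset_chain_def)
      then show ?thesis
        using KL ideal_setD(2)[OF ideals(1)] by blast
    qed
    moreover have "0 \<in> \<Union>\<C>"
      using \<C>(1) ideal_setD(1)[OF ideals(1)] by blast
    moreover have "a * x \<in> \<Union>\<C>" if "x \<in> \<Union>\<C>" for a x
      using that ideal_setD(3)[OF ideals(1)] by blast
    ultimately have "ideal_set (\<Union>\<C>)"
      by (simp add: ideal_set_def)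
    then show ?thesis
      using \<C>(1) ideals(2,3) by (auto simp: \<A>_def)
  qed
  moreover have "\<A> \<noteq> {}"
    using assms by (auto simp: \<A>_def)
  ultimately obtain M where M: "M \<in> \<A>" "\<And>K. K \<in> \<A> \<Longrightarrow> M \<subseteq> K \<Longrightarrow> K = M"
    using subset_Zorn_nonempty[of \<A>] by blast
  then have ideal: "ideal_set M" "1 \<notin> M" "J \<subseteq> M"
    by (auto simp: \<A>_def)
  have "\<exists>r. r * x - 1 \<in> M" if "x \<notin> M" for x
  proof -
    define K where "K = {m + r * x | m r. m \<in> M}"
    have "ideal_set K"
      unfolding ideal_set_def
    proof (intro conjI ballI allI)
      have "0 + 0 * x \<in> K"
        unfolding K_def using ideal_setD(1)[OF ideal(1)] by blast
      then show "0 \<in> K"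
        by simp
      fix y assume "y \<in> K"
      then obtain m r where y: "y = m + r * x" "m \<in> M"
        by (auto simp: K_def)
      show "a * y \<in> K" for a
      proof -
        have "a * m + (a * r) * x \<in> K"
          unfolding K_def using ideal_setD(3)[OF ideal(1) y(2)] by blast
        then show ?thesis
          by (simp add: y(1) algebra_simps)
      qed
      fix z assume "z \<in> K"
      then obtain m' r' where z: "z = m' + r' * x" "m' \<in> M"
        by (auto simp: K_def)
      have "(m + m') + (r + r') * x \<in> K"
        unfolding K_def using ideal_setD(2)[OF ideal(1) y(2) z(2)] by blast
      then show "y + z \<in> K"
        by (simp add: y(1) z(1) algebra_simps)
    qed
    moreover have "M \<subseteq> K"
    proof
      fix m assume "m \<in> M"
      then have "m + 0 * x \<in> K"
        unfolding K_def by blast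
      then show "m \<in> K"
        by simp
    qed
    moreover have "0 + 1 * x \<in> K"
      unfolding K_def using ideal_setD(1)[OF ideal(1)] by blast
    ultimately have "K \<notin> \<A>"
      using M(2)[of K] that by auto
    then have "1 \<in> K"
      using \<open>ideal_set K\<close> \<open>M \<subseteq> K\<close> ideal(3) by (auto simp: \<A>_def)
    then obtain m r where "1 = m + r * x" "m \<in> M"
      by (auto simp: K_def)
    then have "r * x - 1 = - 1 * m" "m \<in> M"
      by (auto simp: algebra_simps)
    then show ?thesis
      using ideal_setD(3)[OF ideal(1), of m "- 1"] by metis
  qed
  with ideal show ?thesis
    by (rule that)
qed

section \<open>Inversion near the unit element\<close>

text \<open>Since the units are open, a limit at \<open>1\<close> within the units is a limit in the whole algebra.\<close>
lemma near_one_invertible: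
  fixes f :: "'b \<Rightarrow> 'a::continuous_inverse_algebra"
  assumes "(f \<longlongrightarrow> 1) F"
  shows "\<forall>\<^sub>F x in F. f x * ring_inverse (f x) = 1"
    and "((\<lambda>x. ring_inverse (f x)) \<longlongrightarrow> 1) F"
proof -
  have inv: "y * ring_inverse y = 1" if y: "y \<in> ring_units" for y :: 'a
  proof -
    obtain z where z: "y * z = 1" "z * y = 1"
      using y by (auto simp: ring_units_def)
    then show ?thesis
      using ring_inverse_eq[OF z] by simp
  qed
  have one: "(1 :: 'a) \<in> ring_units" "ring_inverse (1 :: 'a) = 1"
    by (auto simp: ring_units_def intro!: ring_inverse_eq exI[of _ 1])
  have "\<forall>\<^sub>F x in F. f x \<in> ring_units"
    using topological_tendstoD[OF assms open_ring_units] one by blast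
  then show "\<forall>\<^sub>F x in F. f x * ring_inverse (f x) = 1"
    by eventually_elim (rule inv)
  have "at (1 :: 'a) within ring_units = at 1"
    by (rule at_within_open[OF one(1) open_ring_units])
  then have "(ring_inverse \<longlongrightarrow> ring_inverse (1 :: 'a)) (at 1)"
    using tendsto_ring_inverse one(2) by metis
  then have "(ring_inverse \<longlongrightarrow> ring_inverse (1 :: 'a)) (nhds 1)"
    by (simp add: tendsto_at_iff_tendsto_nhds)
  from filterlim_compose[OF this assms] show "((\<lambda>x. ring_inverse (f x)) \<longlongrightarrow> 1) F"
    by (simp add: one(2))
qed

section \<open>A continuous functional that annihilates a proper ideal\<close>

lemma scaleC_in_ideal:
  fixes M :: "'a::{continuous_inverse_algebra, comm_ring_1} set"
  assumes "ideal_set M" "x \<in> M"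
  shows "c *\<^sub>C x \<in> M"
  using ideal_setD(3)[OF assms, of "c *\<^sub>C 1"] by (simp add: mult_scaleC_left)

lemma scaleC_minus_left: "(- c) *\<^sub>C x = - (c *\<^sub>C x :: 'a::complex_algebra_1)"
proof -
  have "0 *\<^sub>C x = 0"
    using scaleC_of_real[of 0 x] by simp
  then have "c *\<^sub>C x + (- c) *\<^sub>C x = 0"
    using scaleC_add_left[of c "- c" x] by simp
  then show ?thesis
    by (simp add: add_eq_0_iff)
qed

text \<open>No element of a convex symmetric \<open>V\<close> with \<open>1 + V\<close> inside the units can equal
  \<open>- (1 + m)\<close> with \<open>m\<close> in \<open>M\<close>, because \<open>M\<close> contains no unit. So the gauge of
  \<open>V\<close> induces a seminorm on the quotient by \<open>M\<close> that is at least \<open>1\<close> at the unit element. The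
  Hahn-Banach theorem yields a real functional below it, and \<open>f x - \<i> f (\<i> x)\<close> is its
  complex linear version.\<close>
lemma functional_annihilating_ideal:
  fixes M :: "'a::{continuous_inverse_algebra, comm_ring_1} set"
  assumes M: "ideal_set M" "1 \<notin> M"
  obtains L :: "'a \<Rightarrow> complex"
  where "\<And>x y. L (x + y) = L x + L y" "\<And>c x. L (c *\<^sub>C x) = c * L x"
    "\<And>x. x \<in> M \<Longrightarrow> L x = 0" "L 1 \<noteq> 0" "(L \<longlongrightarrow> 0) (nhds 0)"
proof -
  let ?U = "(\<lambda>x. 1 + x) -` ring_units :: 'a set"
  have "open ?U"
    by (intro open_vimage open_ring_units continuous_intros)
  moreover have "0 \<in> ?U"
    by (auto simp: ring_units_def intro: exI[of _ 1])
  ultimately obtain V where V: "open V" "V \<subseteq> ?U" "absorbing_disc V"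
    by (rule symmetric_convex_neighbourhood)
  interpret V: absorbing_disc V by fact
  define p where "p = gauge_of V"
  have sp: "seminorm p" and lim: "(p \<longlongrightarrow> 0) (nhds 0)"
    unfolding p_def by (rule V.seminorm_gauge V.tendsto_gauge)+
  have far: "1 \<le> p (1 + m)" if "m \<in> M" for m
  proof (rule ccontr)
    assume "\<not> 1 \<le> p (1 + m)"
    then have "- (1 + m) \<in> V"
      unfolding p_def by (intro V.uminus_mem V.mem_if_gauge_less_1) simp
    then have "1 + - (1 + m) \<in> ring_units"
      using V(2) by blast
    then obtain y where "1 = (- y) * m"
      by (auto simp: ring_units_def algebra_simps)
    then show False
      using ideal_setD(3)[OF M(1) that, of "- y"] M(2) by metis
  qed
  define q where "q x = (INF m\<in>M. p (x + m))" for x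
  have bdd: "bdd_below ((\<lambda>m. p (x + m)) ` M)" for x
    using seminorm_nonneg[OF sp] by (intro bdd_belowI2)
  have ne: "M \<noteq> {}"
    using ideal_setD(1)[OF M(1)] by blast
  have q_le: "q x \<le> p (x + m)" if "m \<in> M" for x m
    unfolding q_def using that by (intro cINF_lower bdd)
  have q_near: "\<exists>m\<in>M. p (x + m) < q x + e" if "0 < e" for x e
    using cINF_less_iff[OF ne bdd, of x "q x + e"] that by (simp add: q_def)
  have "q (x + y) \<le> q x + q y" for x y
  proof (rule field_le_epsilon)
    fix e :: real assume "0 < e"
    obtain m where m: "m \<in> M" "p (x + m) < q x + e / 2"
      using q_near[of "e / 2" x] \<open>0 < e\<close> by auto
    obtain n where n: "n \<in> M" "p (y + n) < q y + e / 2"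
      using q_near[of "e / 2" y] \<open>0 < e\<close> by auto
    have "q (x + y) \<le> p ((x + m) + (y + n))"
      using q_le[OF ideal_setD(2)[OF M(1) m(1) n(1)], of "x + y"] by (simp add: algebra_simps)
    then show "q (x + y) \<le> q x + q y + e"
      using seminorm_triangle[OF sp, of "x + m" "y + n"] m(2) n(2) by simp
  qed
  moreover have le: "q (r *\<^sub>R x) \<le> r * q x" if "0 < r" for r x
  proof (rule field_le_epsilon)
    fix e :: real assume "0 < e"
    obtain m where m: "m \<in> M" "p (x + m) < q x + e / r"
      using q_near[of "e / r" x] \<open>0 < e\<close> \<open>0 < r\<close> by auto
    have "r *\<^sub>R m \<in> M"
      using scaleC_in_ideal[OF M(1) m(1), of "complex_of_real r"] by (simp add: scaleC_of_real)
    then have "q (r *\<^sub>R x) \<le> p (r *\<^sub>R (x + m))"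
      using q_le[of "r *\<^sub>R m" "r *\<^sub>R x"] by (simp add: scaleR_add_right)
    also have "\<dots> = r * p (x + m)"
      using \<open>0 < r\<close> by (simp add: seminorm_scaleR[OF sp])
    also have "\<dots> \<le> r * (q x + e / r)"
      using m(2) \<open>0 < r\<close> by (intro mult_left_mono) auto
    finally show "q (r *\<^sub>R x) \<le> r * q x + e"
      using \<open>0 < r\<close> by (simp add: distrib_left)
  qed
  moreover have "r * q x \<le> q (r *\<^sub>R x)" if "0 < r" for r x
  proof -
    have "q x \<le> inverse r * q (r *\<^sub>R x)"
      using le[of "inverse r" "r *\<^sub>R x"] that by simp
    then show ?thesis
      using that by (simp add: field_simps)
  qed
  ultimately have "sublinear q"
    unfolding sublinear_def by (auto intro: antisym)
  then obtain f where f: "linear f" "\<And>x. f x \<le> q x" "f 1 = q 1"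
    using linear_functional_below_sublinear by blast
  have f_le: "f x \<le> p x" for x
    using f(2)[of x] q_le[OF ideal_setD(1)[OF M(1)], of x] by simp
  have "1 \<le> q 1"
    unfolding q_def using far by (intro cINF_greatest ne)
  have f_nonpos: "f x \<le> 0" if "x \<in> M" for x
    using f(2)[of x] q_le[of "- x" x] ideal_setD(3)[OF M(1) that, of "- 1"] by (simp add: seminorm_zero[OF sp])
  have f_zero: "f x = 0" if "x \<in> M" for x
    using f_nonpos[OF that] f_nonpos[OF ideal_setD(3)[OF M(1) that, of "- 1"]] linear_neg[OF f(1), of x]
    by simp
  have f_abs: "\<bar>f x\<bar> \<le> p x" for x
    using f_le[of x] f_le[of "- x"] linear_neg[OF f(1), of x] seminorm_minus[OF sp, of x] by simp
  have f_lim: "(f \<longlongrightarrow> 0) (nhds 0)"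
    by (rule Lim_null_comparison[OF _ lim]) (simp add: f_abs)
  define L where "L x = Complex (f x) (- f (\<i> *\<^sub>C x))" for x
  have L_add: "L (x + y) = L x + L y" for x y
    by (simp add: L_def complex_eq_iff linear_add[OF f(1)] scaleC_add_right)
  have f_scaleC: "f (c *\<^sub>C x) = Re c * f x + Im c * f (\<i> *\<^sub>C x)" for c x
  proof -
    have "c *\<^sub>C x = Re c *\<^sub>R x + Im c *\<^sub>R (\<i> *\<^sub>C x)"
      by (simp add: scaleC_scaleC scaleC_add_left[symmetric] complex_eq[symmetric] mult.commute
          flip: scaleC_of_real)
    then show ?thesis
      by (simp add: linear_add[OF f(1)] linear_cmul[OF f(1)])
  qed
  have L_scaleC: "L (c *\<^sub>C x) = c * L x" for c x
    using f_scaleC[of c x] f_scaleC[of "\<i> * c" x]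
    by (simp add: L_def complex_eq_iff scaleC_scaleC)
  have L_zero: "L x = 0" if "x \<in> M" for x
    using f_zero[OF that] f_zero[OF scaleC_in_ideal[OF M(1) that]] by (simp add: L_def complex_eq_iff)
  have "L 1 \<noteq> 0"
    using \<open>1 \<le> q 1\<close> f(3) by (auto simp: L_def complex_eq_iff)
  have "((\<lambda>x. \<i> *\<^sub>C x) \<longlongrightarrow> \<i> *\<^sub>C 0) (nhds (0 :: 'a))"
    by (intro tendsto_scaleC tendsto_const filterlim_ident)
  moreover have "\<i> *\<^sub>C (0 :: 'a) = 0"
    using scaleC_add_right[of \<i> "0 :: 'a" 0] by simp
  ultimately have "((\<lambda>x. f (\<i> *\<^sub>C x)) \<longlongrightarrow> 0) (nhds 0)"
    using filterlim_compose[OF f_lim] by simp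
  from tendsto_Complex[OF f_lim tendsto_minus[OF this]] have "(L \<longlongrightarrow> 0) (nhds 0)"
    by (simp add: L_def[abs_def] zero_complex.code)
  show ?thesis
    by (rule that[OF L_add L_scaleC L_zero \<open>L 1 \<noteq> 0\<close> \<open>(L \<longlongrightarrow> 0) (nhds 0)\<close>])
qed

section \<open>Characters from maximal ideals\<close>

text \<open>Gelfand-Mazur for the quotient field \<open>A / M\<close>, carried out with representatives: \<open>r z\<close> represents
  the inverse of \<open>a - z\<close>, and \<open>L (r z)\<close> does not depend on the representative. Near a point \<open>z\<close>
  one may take \<open>r z * (1 - h r z)\<^sup>-\<^sup>1\<close> to represent the inverse of \<open>a - (z + h)\<close>, and for
  large \<open>w\<close> the element \<open>- w\<^sup>-\<^sup>1 (1 - w\<^sup>-\<^sup>1 a)\<^sup>-\<^sup>1\<close>. These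
  inverses exist in \<open>A\<close> itself and depend continuously on the parameter, because the units are open and
  inversion is continuous at \<open>1\<close>. They give complex differentiability and the limit at infinity.\<close>
theorem scalar_modulo_maximal_ideal:
  fixes M :: "'a::{continuous_inverse_algebra, comm_ring_1} set"
  assumes M: "ideal_set M" "1 \<notin> M" and maximal: "\<And>x. x \<notin> M \<Longrightarrow> \<exists>r. r * x - 1 \<in> M"
  shows "\<exists>z. a - z *\<^sub>C 1 \<in> M"
proof (rule ccontr)
  assume "\<nexists>z. a - z *\<^sub>C 1 \<in> M"
  then have "\<exists>r. r * (a - z *\<^sub>C 1) - 1 \<in> M" for z
    using maximal by blast
  then obtain r where r: "\<And>z. r z * (a - z *\<^sub>C 1) - 1 \<in> M"
    by metis
  obtain L where L_add: "\<And>x y. L (x + y) = L x + L y" and L_scaleC: "\<And>c x. L (c *\<^sub>C x) = c * L x"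
    and L_zero: "\<And>x. x \<in> M \<Longrightarrow> L x = 0" and L_one: "L 1 \<noteq> (0::complex)" and L_lim: "(L \<longlongrightarrow> 0) (nhds 0)"
    using functional_annihilating_ideal[OF M] by blast
  have L_diff: "L (x - y) = L x - L y" for x y
    using L_add[of "x - y" y] by simp
  have L_tendsto: "((\<lambda>y. L (f y)) \<longlongrightarrow> L x) F" if "(f \<longlongrightarrow> x) F" for f x and F :: "complex filter"
  proof -
    have "((\<lambda>y. f y - x) \<longlongrightarrow> x - x) F"
      by (intro tendsto_diff that tendsto_const)
    then have "((\<lambda>y. L (f y - x)) \<longlongrightarrow> 0) F"
      using filterlim_compose[OF L_lim] by simp
    then show ?thesis
      by (simp add: L_diff Lim_null[symmetric])
  qed
  have zero: "0 *\<^sub>C x = 0" for x :: 'a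
    using scaleC_of_real[of 0 x] by simp
  have unique: "s - r z \<in> M" if "s * (a - z *\<^sub>C 1) - 1 \<in> M" for s z
  proof -
    have "s - r z = r z * (s * (a - z *\<^sub>C 1) - 1) - s * (r z * (a - z *\<^sub>C 1) - 1)"
      by (simp add: algebra_simps)
    then show ?thesis
      using ideal_set_diff[OF M(1) ideal_setD(3)[OF M(1) that, of "r z"] ideal_setD(3)[OF M(1) r[of z], of s]]
      by metis
  qed
  define g where "g z = L (r z)" for z
  have g_eq: "g z = L s" if "s * (a - z *\<^sub>C 1) - 1 \<in> M" for s z
    using L_zero[OF unique[OF that]] by (simp add: L_diff g_def)
  have "(g has_field_derivative L (r z * r z)) (at z)" for z
    unfolding DERIV_def
  proof (rule Lim_transform_eventually)
    define i where "i h = ring_inverse (1 - h *\<^sub>C r z)" for h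
    have "((\<lambda>h. 1 - h *\<^sub>C r z) \<longlongrightarrow> 1 - 0 *\<^sub>C r z) (at 0)"
      by (intro tendsto_diff tendsto_scaleC tendsto_const tendsto_ident_at)
    then have "((\<lambda>h. 1 - h *\<^sub>C r z) \<longlongrightarrow> 1) (at 0)"
      by (simp add: zero)
    note i = near_one_invertible[OF this, folded i_def]
    have "((\<lambda>h. r z * r z * i h) \<longlongrightarrow> r z * r z * 1) (at 0)"
      by (intro tendsto_mult tendsto_const i(2))
    then show "((\<lambda>h. L (r z * r z * i h)) \<longlongrightarrow> L (r z * r z)) (at 0)"
      by (intro L_tendsto) simp
    show "\<forall>\<^sub>F h in at 0. L (r z * r z * i h) = (g (z + h) - g z) / h"
      using i(1) eventually_neq_at_within[of 0 0]
    proof eventually_elim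
      case (elim h)
      \<comment> \<open>By this identity \<open>r z * i h\<close> represents the inverse of \<open>a - (z + h)\<close>.\<close>
      have "r z * i h * (a - (z + h) *\<^sub>C 1) - 1
          = i h * (r z * (a - z *\<^sub>C 1) - 1) + ((1 - h *\<^sub>C r z) * i h - 1)"
        by (simp add: algebra_simps scaleC_add_left mult_scaleC_left mult_scaleC_right)
      then have "r z * i h * (a - (z + h) *\<^sub>C 1) - 1 \<in> M"
        using ideal_setD(3)[OF M(1) r[of z], of "i h"] elim(1) by simp
      then have "g (z + h) = L (r z * i h)"
        by (rule g_eq)
      moreover have "r z * i h - r z = h *\<^sub>C (r z * r z * i h) + r z * ((1 - h *\<^sub>C r z) * i h - 1)"
        by (simp add: algebra_simps mult_scaleC_left mult_scaleC_right)
      then have "r z * i h - r z = h *\<^sub>C (r z * r z * i h)"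
        using elim(1) by simp
      then have "L (r z * i h) - L (r z) = h * L (r z * r z * i h)"
        by (metis L_diff L_scaleC)
      ultimately show ?case
        using elim(2) by (simp add: g_def)
    qed
  qed
  then have holomorphic: "g holomorphic_on UNIV"
    by (auto simp: holomorphic_on_open)
  define i where "i w = ring_inverse (1 - inverse w *\<^sub>C a)" for w
  have "((\<lambda>w. 1 - inverse w *\<^sub>C a) \<longlongrightarrow> 1 - 0 *\<^sub>C a) at_infinity"
    by (intro tendsto_diff tendsto_scaleC tendsto_const tendsto_inverse_0)
  then have "((\<lambda>w. 1 - inverse w *\<^sub>C a) \<longlongrightarrow> 1) at_infinity"
    by (simp add: zero)
  note i = near_one_invertible[OF this, folded i_def]
  \<comment> \<open>Here \<open>- w\<^sup>-\<^sup>1 i w\<close> is inverse to \<open>a - w\<close>, so \<open>g w = - w\<^sup>-\<^sup>1 L (i w)\<close>.\<close>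
  have large: "\<forall>\<^sub>F w in at_infinity. w * g w = - L (i w)"
    using i(1) eventually_not_equal_at_infinity[of 0]
  proof eventually_elim
    case (elim w)
    have "(- inverse w) *\<^sub>C i w * (a - w *\<^sub>C 1) = (inverse w * w) *\<^sub>C i w - inverse w *\<^sub>C (a * i w)"
      by (simp add: algebra_simps mult_scaleC_left mult_scaleC_right scaleC_scaleC scaleC_minus_left)
    also have "\<dots> = (1 - inverse w *\<^sub>C a) * i w"
      using elim(2) by (simp add: scaleC_one mult_scaleC_left left_diff_distrib)
    finally have "(- inverse w) *\<^sub>C i w * (a - w *\<^sub>C 1) - 1 \<in> M"
      using elim(1) ideal_setD(1)[OF M(1)] by simp
    then have "g w = L ((- inverse w) *\<^sub>C i w)"
      by (rule g_eq)
    then show ?case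
      using elim(2) by (simp add: L_scaleC)
  qed
  have lim: "((\<lambda>w. - L (i w)) \<longlongrightarrow> - L 1) at_infinity"
    by (intro tendsto_minus L_tendsto i(2))
  have "((\<lambda>w. inverse w * - L (i w)) \<longlongrightarrow> 0 * - L 1) at_infinity"
    by (intro tendsto_mult tendsto_inverse_0 lim)
  moreover have "\<forall>\<^sub>F w in at_infinity. inverse w * - L (i w) = g w"
    using large eventually_not_equal_at_infinity[of 0]
    by eventually_elim (simp add: field_simps)
  ultimately have "(g \<longlongrightarrow> 0) at_infinity"
    using Lim_transform_eventually by fastforce
  then have "g w = 0" for w
    by (rule Liouville_weak_0[OF holomorphic])
  then have "\<forall>\<^sub>F w in at_infinity. - L (i w) = 0"
    using large by simp
  then have "((\<lambda>w. - L (i w)) \<longlongrightarrow> 0) at_infinity"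
    by (rule tendsto_eventually)
  from tendsto_unique[OF trivial_limit_at_infinity lim this] L_one show False
    by simp
qed

text \<open>For a maximal ideal \<open>M\<close> above \<open>J\<close>, the algebra is the direct sum of \<open>M\<close> and the
  scalars; the character is the projection to the scalars.\<close>
theorem character_vanishing_on_ideal:
  fixes J :: "'a::{continuous_inverse_algebra, comm_ring_1} set"
  assumes "ideal_set J" "1 \<notin> J"
  obtains \<psi> where "character_on UNIV \<psi>" "\<And>x. x \<in> J \<Longrightarrow> \<psi> x = 0"
proof -
  obtain M where M: "ideal_set M" "1 \<notin> M" "J \<subseteq> M" "\<And>x. x \<notin> M \<Longrightarrow> \<exists>r. r * x - 1 \<in> M"
    using maximal_ideal_exists[OF assms] by blast
  have "\<exists>z. a - z *\<^sub>C 1 \<in> M" for a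
    by (rule scalar_modulo_maximal_ideal[OF M(1,2,4)])
  then obtain \<psi> where \<psi>: "\<And>a. a - \<psi> a *\<^sub>C 1 \<in> M"
    by metis
  have unique: "\<psi> a = z" if "a - z *\<^sub>C 1 \<in> M" for a z
  proof (rule ccontr)
    assume "\<psi> a \<noteq> z"
    have "a - z *\<^sub>C 1 - (a - \<psi> a *\<^sub>C 1) = (\<psi> a - z) *\<^sub>C 1"
      using scaleC_add_left[of "\<psi> a - z" z "1 :: 'a"] by simp
    then have "(\<psi> a - z) *\<^sub>C 1 \<in> M"
      using ideal_set_diff[OF M(1) that \<psi>[of a]] by metis
    from scaleC_in_ideal[OF M(1) this, of "inverse (\<psi> a - z)"] have "1 \<in> M"
      using \<open>\<psi> a \<noteq> z\<close> by (simp add: scaleC_scaleC scaleC_one)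
    then show False
      using M(2) by blast
  qed
  have zero: "0 *\<^sub>C (1 :: 'a) = 0"
    using scaleC_of_real[of 0 "1 :: 'a"] by simp
  have add: "\<psi> (x + y) = \<psi> x + \<psi> y" for x y
    using ideal_setD(2)[OF M(1) \<psi>[of x] \<psi>[of y]]
    by (intro unique) (simp add: scaleC_add_left algebra_simps)
  have mult: "\<psi> (x * y) = \<psi> x * \<psi> y" for x y
  proof (rule unique)
    have "x * y - (\<psi> x * \<psi> y) *\<^sub>C 1 = y * (x - \<psi> x *\<^sub>C 1) + \<psi> x *\<^sub>C (y - \<psi> y *\<^sub>C 1)"
      using scaleC_add_right[of "\<psi> x" "y - \<psi> y *\<^sub>C 1" "\<psi> y *\<^sub>C 1"]
      by (simp add: algebra_simps mult_scaleC_right mult_scaleC_left scaleC_scaleC)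
    then show "x * y - (\<psi> x * \<psi> y) *\<^sub>C 1 \<in> M"
      using ideal_setD(2)[OF M(1) ideal_setD(3)[OF M(1) \<psi>[of x], of y] scaleC_in_ideal[OF M(1) \<psi>[of y], of "\<psi> x"]]
      by metis
  qed
  have scale: "\<psi> (c *\<^sub>C x) = c * \<psi> x" for c x
  proof -
    have "\<psi> (c *\<^sub>C 1) = c"
      by (rule unique) (simp add: ideal_setD(1)[OF M(1)])
    then show ?thesis
      using mult[of "c *\<^sub>C 1" x] by (simp add: mult_scaleC_left)
  qed
  have "\<psi> 1 = 1"
    by (rule unique) (simp add: ideal_setD(1)[OF M(1)] scaleC_one)
  then have "character_on UNIV \<psi>"
    by (auto simp: character_on_def add mult scale intro: exI[of _ 1])
  moreover have "\<psi> x = 0" if "x \<in> J" for x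
    using that M(3) by (intro unique) (auto simp: zero)
  ultimately show ?thesis
    by (rule that)
qed

section \<open>Extension of characters\<close>

lemma character_on_fixed_points_one:
  assumes "dynamical_system \<alpha>" "character_on (fixed_point_algebra \<alpha>) \<phi>"
  shows "\<phi> 1 = 1"
proof -
  have one: "1 \<in> fixed_point_algebra \<alpha>"
    using assms(1) by (auto simp: dynamical_system_def algebra_automorphism_def fixed_point_algebra_def)
  obtain x where x: "x \<in> fixed_point_algebra \<alpha>" "\<phi> x \<noteq> 0"
    using assms(2) by (auto simp: character_on_def)
  have "\<phi> (x * 1) = \<phi> x * \<phi> 1"
    using assms(2) x(1) one by (simp add: character_on_def del: mult_1_right)
  then show ?thesis
    using x(2) by simp
qed

theorem proposition6p4p12:
  fixes \<alpha> :: "'g::topological_group_add \<Rightarrow> 'a::{continuous_inverse_algebra, comm_ring_1} \<Rightarrow> 'a"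
    and \<phi> :: "'a \<Rightarrow> complex"
  assumes "complete (UNIV :: 'a set)"
    and "compact (UNIV :: 'g set)"
    and "dynamical_system \<alpha>"
    and "character_on (fixed_point_algebra \<alpha>) \<phi>"
  shows "\<exists>\<phi>'. character_on UNIV \<phi>' \<and> (\<forall>a\<in>fixed_point_algebra \<alpha>. \<phi>' a = \<phi> a)"
proof -
  interpret compact_dynamical_system \<alpha>
    using assms(2,3) by unfold_locales
  let ?B = "fixed_point_algebra \<alpha>"
  note closed = fixed_point_algebra_closed[OF assms(3)]
  have \<phi>_add: "\<phi> (x + y) = \<phi> x + \<phi> y" and \<phi>_mult: "\<phi> (x * y) = \<phi> x * \<phi> y"
    and \<phi>_scale: "\<phi> (c *\<^sub>C x) = c * \<phi> x" if "x \<in> ?B" "y \<in> ?B" for x y c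
    using assms(4) that by (auto simp: character_on_def)
  have \<phi>_one: "\<phi> 1 = 1"
    by (rule character_on_fixed_points_one[OF assms(3,4)])
  have zero: "0 \<in> ?B"
    using linear_0[OF linear_action] by (simp add: fixed_point_iff)
  have one: "1 \<in> ?B"
    by (rule closed(4)[OF zero zero])
  have \<phi>_zero: "\<phi> 0 = 0"
    using \<phi>_add[OF zero zero] by simp
  obtain mean where mean: "is_mean a (mean a)" for a
    using mean_exists[OF assms(1)] by metis
  have mean_in: "mean a \<in> ?B" for a
    using mean by (simp add: is_mean_def)
  have mean_eqI: "mean a = c" if "is_mean a c" for a c
    using is_mean_unique[OF mean that] .
  define J where "J = {x. \<forall>a. \<phi> (mean (a * x)) = 0}"
  have "ideal_set J"
    unfolding ideal_set_def
  proof (intro conjI ballI allI)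
    show "0 \<in> J"
      using mean_eqI[OF is_mean_fixed[OF zero]] by (simp add: J_def \<phi>_zero)
  next
    fix x y assume "x \<in> J" "y \<in> J"
    moreover have "mean (a * (x + y)) = mean (a * x) + mean (a * y)" for a
      unfolding distrib_left by (rule mean_eqI[OF is_mean_add[OF mean mean]])
    ultimately show "x + y \<in> J"
      by (simp add: J_def \<phi>_add mean_in)
  next
    fix a x assume "x \<in> J"
    then show "a * x \<in> J"
      by (simp add: J_def mult.assoc[symmetric])
  qed
  moreover have "1 \<notin> J"
  proof
    assume "1 \<in> J"
    then have "\<phi> (mean (1 * 1)) = 0"
      unfolding J_def by blast
    then show False
      using mean_eqI[OF is_mean_fixed[OF one]] by (simp add: \<phi>_one)
  qed
  ultimately obtain \<psi> where \<psi>: "character_on UNIV \<psi>" "\<And>x. x \<in> J \<Longrightarrow> \<psi> x = 0"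
    using character_vanishing_on_ideal by blast
  have kernel: "x \<in> J" if x: "x \<in> ?B" "\<phi> x = 0" for x
  proof -
    have "mean (a * x) = mean a * x" for a
      by (rule mean_eqI[OF is_mean_mult_fixed[OF mean x(1)]])
    then show ?thesis
      using x by (simp add: J_def \<phi>_mult mean_in)
  qed
  have \<psi>_add: "\<psi> (x + y) = \<psi> x + \<psi> y" and \<psi>_scale: "\<psi> (c *\<^sub>C x) = c * \<psi> x"
    and \<psi>_mult: "\<psi> (x * y) = \<psi> x * \<psi> y" for x y c
    using \<psi>(1) by (auto simp: character_on_def)
  obtain x where "\<psi> x \<noteq> 0"
    using \<psi>(1) by (auto simp: character_on_def)
  then have \<psi>_one: "\<psi> 1 = 1"
    using \<psi>_mult[of x 1] by simp
  have "\<psi> b = \<phi> b" if b: "b \<in> ?B" for b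
  proof -
    have "(- \<phi> b) *\<^sub>C 1 \<in> ?B"
      by (rule closed(3)[OF one one])
    then have "b + (- \<phi> b) *\<^sub>C 1 \<in> J"
      using b by (intro kernel closed(1)) (simp_all add: \<phi>_add \<phi>_scale[OF one one] \<phi>_one)
    then have "\<psi> (b + (- \<phi> b) *\<^sub>C 1) = 0"
      by (rule \<psi>(2))
    then show ?thesis
      by (simp add: \<psi>_add \<psi>_scale \<psi>_one)
  qed
  with \<psi>(1) show ?thesis
    by blast
qed

end
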